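(* Let $M$ be an irreducible weight $\mathcal{L}$-module, where $\mathcal{L}=W(2,2)$. Assume that there exists $\lambda\in\mathbb{C}$ such that $\dim M_\lambda=\infty$. Then $\mathrm{Supp}(M)=\lambda+\mathbb{Z}$, and for every $k\in\mathbb{Z}$ we have $\dim M_{\lambda+k}=\infty$.
   Context: The $W$-algebra $\mathcal{L}=W(2,2)$ is the Lie algebra over $\mathbb{C}$ with basis $\{x_n, I(n), C, C_1 \mid n\in\mathbb{Z}\}$ and Lie bracket $$[x_n,x_m]=(m-n)x_{n+m}+\delta_{n,-m}\tfrac{n^3-n}{12}C,\qquad [x_n,I(m)]=(m-n)I(n+m)+\delta_{n,-m}\tfrac{n^3-n}{12}C_1,$$ $$[I(n),I(m)]=0,\qquad [\mathcal{L},C]=[\mathcal{L},C_1]=0.$$ For an $\mathcal{L}$-module $V$ and $\lambda\in\mathbb{C}$, the weight space is $V_\lambda=\{v\in V\mid x_0v=\lambda v\}$. An $\mathcal{L}$-module $V$ is a weight module if it is the sum of all its weight spaces. The support of a weight module is $\mathrm{Supp}(V)=\{\lambda\in\mathbb{C}\mid V_\lambda\neq 0\}$. *)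

theory Defs
  imports Complex_Main "HOL-Library.Poly_Mapping"
begin

section \<open>Lie algebras and their modules\<close>

locale lie_algebra = vector_space scaleL
  for scaleL :: "'k::field \<Rightarrow> 'l::ab_group_add \<Rightarrow> 'l" +
  fixes bracket :: "'l \<Rightarrow> 'l \<Rightarrow> 'l"
  assumes bracket_add_left: "bracket (x + y) z = bracket x z + bracket y z"
    and bracket_add_right: "bracket x (y + z) = bracket x y + bracket x z"
    and bracket_scale_left: "bracket (scaleL c x) y = scaleL c (bracket x y)"
    and bracket_scale_right: "bracket x (scaleL c y) = scaleL c (bracket x y)"
    and bracket_self: "bracket x x = 0"
    and jacobi: "bracket x (bracket y z) + bracket y (bracket z x) + bracket z (bracket x y) = 0"

locale lie_module = L: lie_algebra scaleL bracket + V: vector_space scale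
  for scaleL :: "'k::field \<Rightarrow> 'l::ab_group_add \<Rightarrow> 'l"
    and bracket :: "'l \<Rightarrow> 'l \<Rightarrow> 'l"
    and scale :: "'k \<Rightarrow> 'v::ab_group_add \<Rightarrow> 'v" +
  fixes act :: "'l \<Rightarrow> 'v \<Rightarrow> 'v"
  assumes act_add_left: "act (x + y) v = act x v + act y v"
    and act_add_right: "act x (v + w) = act x v + act x w"
    and act_scale_left: "act (scaleL c x) v = scale c (act x v)"
    and act_scale_right: "act x (scale c v) = scale c (act x v)"
    and act_bracket: "act (bracket x y) v = act x (act y v) - act y (act x v)"
begin

definition submodule :: "'v set \<Rightarrow> bool" where
  "submodule W \<longleftrightarrow> V.subspace W \<and> (\<forall>x. \<forall>w\<in>W. act x w \<in> W)"

definition irreducible :: bool where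
  "irreducible \<longleftrightarrow> (\<exists>v::'v. v \<noteq> 0) \<and> (\<forall>W. submodule W \<longrightarrow> W = {0} \<or> W = UNIV)"

end

text \<open>The library's \<^term>\<open>vector_space.dim\<close> is natural-number valued and does not single out
  infinite-dimensional subspaces, so \<open>dim W = \<infinity>\<close> is the absence of a finite basis of \<open>W\<close>.\<close>

definition (in vector_space) infinite_dim :: "'b set \<Rightarrow> bool" where
  "infinite_dim W \<longleftrightarrow> \<not> (\<exists>B. finite B \<and> independent B \<and> span B = W)"


section \<open>The algebra \<open>W(2,2)\<close>\<close>

datatype w22_basis = x_gen int | I_gen int | C_gen | C1_gen

text \<open>The complex vector space freely spanned by \<^typ>\<open>w22_basis\<close>.\<close>

type_synonym w22 = "w22_basis \<Rightarrow>\<^sub>0 complex"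

definition w22_scale :: "complex \<Rightarrow> w22 \<Rightarrow> w22" where
  "w22_scale c f = Poly_Mapping.map ((*) c) f"

definition w22_of :: "w22_basis \<Rightarrow> w22" where
  "w22_of b = Poly_Mapping.single b 1"

text \<open>The central charge term \<open>\<delta>\<^bsub>n,-m\<^esub> (n\<^sup>3 - n)/12\<close>.\<close>

definition w22_cocycle :: "int \<Rightarrow> int \<Rightarrow> complex" where
  "w22_cocycle n m = (if n = - m then (of_int n ^ 3 - of_int n) / 12 else 0)"

text \<open>The case \<open>[I(n), x\<^sub>m]\<close> is forced by skew-symmetry.\<close>

fun w22_basis_bracket :: "w22_basis \<Rightarrow> w22_basis \<Rightarrow> w22" where
  "w22_basis_bracket (x_gen n) (x_gen m) =
     w22_scale (of_int (m - n)) (w22_of (x_gen (n + m))) + w22_scale (w22_cocycle n m) (w22_of C_gen)"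
| "w22_basis_bracket (x_gen n) (I_gen m) =
     w22_scale (of_int (m - n)) (w22_of (I_gen (n + m))) + w22_scale (w22_cocycle n m) (w22_of C1_gen)"
| "w22_basis_bracket (I_gen n) (x_gen m) =
     - (w22_scale (of_int (n - m)) (w22_of (I_gen (m + n))) + w22_scale (w22_cocycle m n) (w22_of C1_gen))"
| "w22_basis_bracket _ _ = 0"

definition w22_bracket :: "w22 \<Rightarrow> w22 \<Rightarrow> w22" where
  "w22_bracket f g =
     (\<Sum>a\<in>Poly_Mapping.keys f. \<Sum>b\<in>Poly_Mapping.keys g.
        w22_scale (Poly_Mapping.lookup f a * Poly_Mapping.lookup g b) (w22_basis_bracket a b))"

lemma lookup_w22_scale [simp]:
  "Poly_Mapping.lookup (w22_scale c f) a = c * Poly_Mapping.lookup f a"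
  by (simp add: w22_scale_def Poly_Mapping.map.rep_eq when_def)

interpretation w22: vector_space w22_scale
  by unfold_locales (auto intro!: poly_mapping_eqI simp: lookup_add algebra_simps)

lemma w22_bracket_superset:
  assumes "finite A" "finite B" "Poly_Mapping.keys f \<subseteq> A" "Poly_Mapping.keys g \<subseteq> B"
  shows "w22_bracket f g = (\<Sum>a\<in>A. \<Sum>b\<in>B.
     w22_scale (Poly_Mapping.lookup f a * Poly_Mapping.lookup g b) (w22_basis_bracket a b))"
proof -
  have "w22_bracket f g = (\<Sum>a\<in>Poly_Mapping.keys f. \<Sum>b\<in>B.
     w22_scale (Poly_Mapping.lookup f a * Poly_Mapping.lookup g b) (w22_basis_bracket a b))"
    unfolding w22_bracket_def using assms
    by (intro sum.cong refl sum.mono_neutral_left) (auto simp: in_keys_iff)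
  also have "\<dots> = (\<Sum>a\<in>A. \<Sum>b\<in>B.
     w22_scale (Poly_Mapping.lookup f a * Poly_Mapping.lookup g b) (w22_basis_bracket a b))"
    using assms by (intro sum.mono_neutral_left) (auto simp: in_keys_iff)
  finally show ?thesis .
qed

lemma w22_cocycle_skew: "w22_cocycle n m = - w22_cocycle m n"
  by (auto simp: w22_cocycle_def minus_divide_left)

lemma w22_basis_bracket_skew: "w22_basis_bracket a b = - w22_basis_bracket b a"
proof (cases a; cases b)
  fix n m assume ab: "a = x_gen n" "b = x_gen m"
  have 1: "w22_scale (of_int (m - n)) y = - w22_scale (of_int (n - m)) y" for y
    by (rule poly_mapping_eqI) (simp add: algebra_simps)
  have 2: "w22_scale (w22_cocycle n m) y = - w22_scale (w22_cocycle m n) y" for y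
    by (subst w22_cocycle_skew) simp
  show ?thesis unfolding ab w22_basis_bracket.simps 1 2 by (simp add: add.commute)
qed auto

lemma w22_bracket_skew: "w22_bracket f g = - w22_bracket g f"
proof -
  have "w22_bracket g f = (\<Sum>a\<in>Poly_Mapping.keys f. \<Sum>b\<in>Poly_Mapping.keys g.
     w22_scale (Poly_Mapping.lookup g b * Poly_Mapping.lookup f a) (w22_basis_bracket b a))"
    unfolding w22_bracket_def by (rule sum.swap)
  also have "\<dots> = - w22_bracket f g"
    unfolding w22_bracket_def sum_negf [symmetric]
    by (intro sum.cong refl, subst w22_basis_bracket_skew)
      (simp add: w22.scale_minus_right mult.commute)
  finally show ?thesis by simp
qed

lemma w22_bracket_add_left: "w22_bracket (f + g) h = w22_bracket f h + w22_bracket g h"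
proof -
  let ?A = "Poly_Mapping.keys f \<union> Poly_Mapping.keys g"
  let ?B = "Poly_Mapping.keys h"
  have k: "Poly_Mapping.keys (f + g) \<subseteq> ?A" by (rule keys_add)
  show ?thesis
    using k w22_bracket_superset[of ?A ?B "f + g" h] w22_bracket_superset[of ?A ?B f h]
      w22_bracket_superset[of ?A ?B g h]
    by (simp add: lookup_add distrib_right w22.scale_left_distrib sum.distrib)
qed

lemma w22_bracket_scale_left: "w22_bracket (w22_scale c f) h = w22_scale c (w22_bracket f h)"
proof -
  have k: "Poly_Mapping.keys (w22_scale c f) \<subseteq> Poly_Mapping.keys f"
    by (auto simp: in_keys_iff)
  show ?thesis
    by (subst w22_bracket_superset[OF _ _ k order.refl])
      (simp_all add: w22_bracket_def w22.scale_sum_right mult.assoc)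
qed

lemma w22_bracket_add_right: "w22_bracket h (f + g) = w22_bracket h f + w22_bracket h g"
  using w22_bracket_skew w22_bracket_add_left
  by (metis minus_add_distrib)

lemma w22_bracket_scale_right: "w22_bracket h (w22_scale c f) = w22_scale c (w22_bracket h f)"
  using w22_bracket_skew w22_bracket_scale_left
  by (metis w22.scale_minus_right)

lemma w22_bracket_zero [simp]: "w22_bracket 0 h = 0" "w22_bracket h 0 = 0"
  by (simp_all add: w22_bracket_def)

lemma w22_bracket_uminus [simp]:
  "w22_bracket (- f) h = - w22_bracket f h" "w22_bracket h (- f) = - w22_bracket h f"
  using w22_bracket_scale_left[of "-1" f h] w22_bracket_scale_right[of h "-1" f] by simp_all

lemma w22_bracket_diff [simp]:
  "w22_bracket (f - g) h = w22_bracket f h - w22_bracket g h"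
  "w22_bracket h (f - g) = w22_bracket h f - w22_bracket h g"
  by (simp_all only: diff_conv_add_uminus w22_bracket_add_left w22_bracket_add_right
      w22_bracket_uminus)

lemma w22_bracket_of: "w22_bracket (w22_of a) (w22_of b) = w22_basis_bracket a b"
  by (simp add: w22_bracket_def w22_of_def)

lemma w22_induct [case_names zero add scale gen]:
  assumes "P 0" "\<And>f g. P f \<Longrightarrow> P g \<Longrightarrow> P (f + g)" "\<And>c f. P f \<Longrightarrow> P (w22_scale c f)"
    and "\<And>b. P (w22_of b)"
  shows "P f"
proof -
  have "f = (\<Sum>a\<in>Poly_Mapping.keys f. w22_scale (Poly_Mapping.lookup f a) (w22_of a))"
    by (rule poly_mapping_eqI)
      (simp add: lookup_sum w22_of_def lookup_single when_def in_keys_iff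
        if_distrib [of "\<lambda>y. _ * y"] sum.delta cong: if_cong)
  moreover have "P (\<Sum>a\<in>A. w22_scale (Poly_Mapping.lookup f a) (w22_of a))" if "finite A" for A
    using that by (induction A rule: finite_induct) (auto intro: assms)
  ultimately show ?thesis by (metis finite_keys)
qed

lemmas w22_bracket_bilinear =
  w22_bracket_add_left w22_bracket_add_right w22_bracket_scale_left w22_bracket_scale_right

lemma w22_jacobi_of:
  "w22_bracket (w22_of a) (w22_bracket (w22_of b) (w22_of c)) +
   w22_bracket (w22_of b) (w22_bracket (w22_of c) (w22_of a)) +
   w22_bracket (w22_of c) (w22_bracket (w22_of a) (w22_of b)) = 0"
proof (rule poly_mapping_eqI, goal_cases)
  case (1 k)
  have neg: "m = - i - j" if "i + j = - m" for i j m :: int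
    using that by simp
  show ?case
    apply (cases a; cases b; cases c; cases k)
    apply (simp_all add: w22_bracket_of w22_bracket_bilinear lookup_add lookup_minus)
    apply (simp_all add: w22_of_def lookup_single when_def)
    apply (auto simp: algebra_simps w22_cocycle_def)
    subgoal by (drule neg, clarify) (simp add: field_simps power3_eq_cube)
    subgoal by (drule neg, clarify) (simp add: field_simps power3_eq_cube)
    subgoal by (drule neg, clarify) (simp add: field_simps power3_eq_cube)
    subgoal by (drule neg, clarify) (simp add: field_simps power3_eq_cube)
    done
qed

lemma w22_jacobi:
  "w22_bracket x (w22_bracket y z) + w22_bracket y (w22_bracket z x) +
   w22_bracket z (w22_bracket x y) = 0" (is "?J x y z = 0")
proof -
  have add: "?J (x + x') y z = ?J x y z + ?J x' y z" "?J x (y + y') z = ?J x y z + ?J x y' z"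
    "?J x y (z + z') = ?J x y z + ?J x y z'" for x x' y y' z z'
    by (simp_all add: w22_bracket_bilinear algebra_simps)
  have scale: "?J (w22_scale c x) y z = w22_scale c (?J x y z)"
    "?J x (w22_scale c y) z = w22_scale c (?J x y z)"
    "?J x y (w22_scale c z) = w22_scale c (?J x y z)" for c x y z
    by (simp_all add: w22_bracket_bilinear w22.scale_right_distrib)
  have 1: "?J (w22_of a) (w22_of b) z = 0" for a b
  proof (induction z rule: w22_induct)
    case (gen d) show ?case by (rule w22_jacobi_of)
  qed (simp_all only: add scale w22_bracket_zero w22.scale_zero_right add_0)
  have 2: "?J (w22_of a) y z = 0" for a
  proof (induction y rule: w22_induct)
    case (gen d) show ?case by (rule 1)
  qed (simp_all only: add scale w22_bracket_zero w22.scale_zero_right add_0)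
  show ?thesis
  proof (induction x rule: w22_induct)
    case (gen d) show ?case by (rule 2)
  qed (simp_all only: add scale w22_bracket_zero w22.scale_zero_right add_0)
qed

interpretation w22: lie_algebra w22_scale w22_bracket
proof
  fix x
  have "Poly_Mapping.lookup (w22_bracket x x) k = - Poly_Mapping.lookup (w22_bracket x x) k" for k
    by (metis lookup_uminus w22_bracket_skew)
  then show "w22_bracket x x = 0" by (intro poly_mapping_eqI) (simp add: eq_neg_iff_add_eq_0)
qed (simp_all add: w22_bracket_bilinear w22_jacobi)


section \<open>Weight modules over \<open>W(2,2)\<close>\<close>

locale w22_module = lie_module w22_scale w22_bracket scale act
  for scale :: "complex \<Rightarrow> 'v::ab_group_add \<Rightarrow> 'v" and act :: "w22 \<Rightarrow> 'v \<Rightarrow> 'v"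
begin

definition weight_space :: "complex \<Rightarrow> 'v set" where
  "weight_space \<mu> = {v. act (w22_of (x_gen 0)) v = scale \<mu> v}"

definition weight_module :: bool where
  "weight_module \<longleftrightarrow> V.span (\<Union>\<mu>. weight_space \<mu>) = UNIV"

definition Supp :: "complex set" where
  "Supp = {\<mu>. weight_space \<mu> \<noteq> {0}}"

end

end

theory Submission
  imports Defs "HOL-Analysis.Continuum_Not_Denumerable"
    "HOL-Computational_Algebra.Fundamental_Theorem_Algebra"
begin

text \<open>
  Let \<open>M\<close> be irreducible with an infinite-dimensional weight space. Weights outside one coset of the
  integers do not occur, since the weight spaces of that coset already span a submodule. It remains
  to exclude a finite-dimensional weight space \<open>M\<^sub>\<mu>\<close> next to an infinite-dimensional one. By the
  automorphism \<open>x\<^sub>n \<mapsto> - x\<^bsub>-n\<^esub>\<close>, \<open>I(n) \<mapsto> - I(-n)\<close> the latter may be taken to be \<open>M\<^bsub>\<mu>-1\<^esub>\<close>.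

  There are two inputs. First, \<open>M\<close> has no highest and no lowest weight vector: such a vector would
  generate a module with finite-dimensional weight spaces (\<open>no_highest_weight_vector\<close>). This needs an
  eigenvector of \<open>I(0)\<close> in a space that may be infinite-dimensional. It is supplied by Dixmier's
  argument, which uses that \<open>M\<close> has countable dimension while the field is uncountable
  (\<open>eigenvector_if_countable_dim\<close>). Secondly, any finite number of operators of degree 1 has a common
  nonzero kernel vector \<open>v\<close> in \<open>M\<^bsub>\<mu>-1\<^esub>\<close>, because they all map into \<open>M\<^sub>\<mu>\<close> (\<open>generic_exists\<close>).

  For such a \<open>v\<close> the relations \<open>[x\<^sub>2, x\<^sub>3] = x\<^sub>5\<close> and \<open>[x\<^sub>2, I(3)] = I(5)\<close>, together with
  \<open>x\<^sub>1 v = I(1) v = 0\<close>, severely restrict how \<open>x\<^sub>1\<close>, \<open>x\<^sub>2\<close>, \<open>I(1)\<close>, \<open>I(2)\<close> act on \<open>x\<^sub>2 v\<close> and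
  \<open>I(2) v\<close> (\<open>generic_relations\<close>). If \<open>\<mu> \<noteq> 0\<close>, the operators of positive degree, or in the mirrored
  situation those of negative degree, kill these vectors. So these vectors vanish, and \<open>v\<close> itself becomes
  a highest weight vector, which is impossible (\<open>generic_weight\<close>).

  For \<open>\<mu> = 0\<close> there is a genuine module to be met, the intermediate series module whose weight 0 is
  missing. One shows that all \<open>I(n)\<close> act by zero (\<open>J_vanishes_if_generic\<close>) and that \<open>M\<close> is exactly
  that module. Its weight spaces are one-dimensional, which contradicts the choice of \<open>M\<^bsub>\<mu>-1\<^esub>\<close>
  (\<open>generic_weight_space_finite\<close>).
\<close>


section \<open>Linear algebra\<close>

context vector_space
begin

text \<open>The defining condition asks for a finite basis. A finite spanning set, even one that reaches
  outside \<open>W\<close>, is easier to produce.\<close>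

lemma infinite_dim_iff:
  assumes "subspace W"
  shows "infinite_dim W \<longleftrightarrow> \<not> (\<exists>B. finite B \<and> W \<subseteq> span B)"
proof -
  have "\<exists>B. finite B \<and> independent B \<and> span B = W" if B: "finite B" "W \<subseteq> span B" for B
  proof -
    obtain B' where B': "B' \<subseteq> W" "independent B'" "W \<subseteq> span B'"
      by (rule maximal_independent_subset)
    have "finite B'" using independent_span_bound[of B B'] B B' by blast
    moreover have "span B' = W" using B' span_minimal[OF B'(1) assms] by blast
    ultimately show ?thesis using B' by blast
  qed
  then show ?thesis unfolding infinite_dim_def by (metis subset_refl)
qed

lemma infinite_dim_nonzero:
  assumes "subspace W" "infinite_dim W"
  obtains v where "v \<in> W" "v \<noteq> 0"
proof -
  have "\<not> W \<subseteq> span {}" using assms infinite_dim_iff by blast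
  then show ?thesis using that by auto
qed

lemma subspace_linear_kernel:
  assumes "subspace E" "Vector_Spaces.linear scale scale f"
  shows "subspace {v\<in>E. f v = 0}"
proof -
  interpret f: Vector_Spaces.linear scale scale f by fact
  show ?thesis using assms(1) by (auto simp: subspace_def f.add f.scale)
qed

text \<open>A basis of the kernel together with preimages of a basis of the image spans everything.\<close>

lemma infinite_dim_kernel:
  assumes E: "subspace E" "infinite_dim E" and lin: "Vector_Spaces.linear scale scale f"
    and fE: "f ` E \<subseteq> F" and F: "subspace F" "\<not> infinite_dim F"
  shows "infinite_dim {v\<in>E. f v = 0}"
proof (rule ccontr)
  interpret f: Vector_Spaces.linear scale scale f by fact
  assume "\<not> ?thesis"
  then obtain B where B: "finite B" "{v\<in>E. f v = 0} \<subseteq> span B"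
    using infinite_dim_iff[OF subspace_linear_kernel[OF E(1) lin]] by blast
  obtain C where C: "finite C" "F \<subseteq> span C" using infinite_dim_iff F by blast
  obtain D where D: "D \<subseteq> f ` E" "independent D" "f ` E \<subseteq> span D"
    by (rule maximal_independent_subset)
  have "finite D" using independent_span_bound[OF C(1) D(2)] D(1) C(2) fE by blast
  then obtain G where G: "G \<subseteq> E" "finite G" "D = f ` G"
    using D(1) by (meson finite_subset_image)
  have "E \<subseteq> span (B \<union> G)"
  proof
    fix v assume v: "v \<in> E"
    then have "f v \<in> f ` span G" using D(3) G(3) f.span_image by auto
    then obtain g where g: "g \<in> span G" "f v = f g" by blast
    have "g \<in> E" using g(1) span_minimal[OF G(1) E(1)] by blast
    then have "v - g \<in> {v\<in>E. f v = 0}" using v g E(1) by (simp add: subspace_diff f.diff)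
    then have "v - g \<in> span (B \<union> G)" using B(2) span_mono[of B "B \<union> G"] by blast
    moreover have "g \<in> span (B \<union> G)" using g(1) span_mono[of G "B \<union> G"] by blast
    ultimately show "v \<in> span (B \<union> G)" using span_add by fastforce
  qed
  then show False using E infinite_dim_iff B(1) G(2) by blast
qed

lemma span_invariant:
  assumes "Vector_Spaces.linear scale scale f" "f ` S \<subseteq> span T" "v \<in> span S"
  shows "f v \<in> span T"
proof -
  interpret f: Vector_Spaces.linear scale scale f by fact
  have "f v \<in> span (f ` S)" using f.span_image assms(3) by blast
  then show ?thesis using span_minimal[OF assms(2)] by auto
qed

text \<open>An eigenvector \<open>x\<close> for \<open>a\<close> differs from a combination of the eigenvectors for \<open>a\<close> in \<open>S\<close> by a
  vector that is killed by a product of factors \<open>f - b\<close> with \<open>b \<noteq> a\<close>; such a product acts on the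
  \<open>a\<close>-eigenspace by a nonzero scalar.\<close>

lemma eigenspace_of_span:
  assumes lin: "Vector_Spaces.linear scale scale f"
    and S: "\<And>s. s \<in> S \<Longrightarrow> \<exists>a. f s = scale a s"
    and x: "x \<in> span S" "f x = scale a x"
  shows "x \<in> span {s\<in>S. f s = scale a s}"
proof -
  interpret f: Vector_Spaces.linear scale scale f by fact
  define g where "g bs v = foldr (\<lambda>b u. f u - scale b u) bs v" for bs v
  have g_simps: "g [] v = v" "g (b # bs) v = f (g bs v) - scale b (g bs v)" for v b bs
    by (simp_all add: g_def)
  have g_add: "g bs (u + v) = g bs u + g bs v" for bs u v
    by (induction bs) (simp_all add: g_simps f.add scale_right_distrib)
  have g_scale: "g bs (scale k v) = scale k (g bs v)" for bs k v
    by (induction bs) (simp_all add: g_simps f.scale scale_right_diff_distrib mult.commute)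
  have g_zero: "g bs 0 = 0" for bs using g_scale[of bs 0 0] by simp
  have g_append: "g (bs @ cs) v = g bs (g cs v)" for bs cs v by (simp add: g_def)
  have g_eig: "g bs v = scale (prod_list (map (\<lambda>b. c - b) bs)) v" if "f v = scale c v" for bs c v
  proof (induction bs)
    case (Cons b bs)
    then show ?case
      by (simp add: g_simps f.scale that algebra_simps scale_left_diff_distrib)
  qed (simp add: g_simps)
  have g_comm: "g bs (g cs v) = g cs (g bs v)" for bs cs v
  proof -
    have 1: "f (g bs v) = g bs (f v)" for bs v
      by (induction bs) (simp_all add: g_simps f.diff f.scale)
    have 2: "g [b] (g cs v) = g cs (g [b] v)" for b cs v
      using g_add[of cs "f v" "scale (-b) v"] g_scale[of cs "-b" v] by (simp add: g_simps 1)
    show ?thesis by (induction bs) (use 2 in \<open>simp_all add: g_simps\<close>)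
  qed
  let ?A = "{s\<in>S. f s = scale a s}"
  define Q where "Q = {q. \<exists>bs. a \<notin> set bs \<and> g bs q = 0}"
  have Q_sub: "subspace Q"
    unfolding subspace_def
  proof (intro conjI ballI allI)
    show "0 \<in> Q" unfolding Q_def using g_zero by (intro CollectI exI[of _ "[]"]) auto
    fix u assume "u \<in> Q"
    then obtain bs where bs: "a \<notin> set bs" "g bs u = 0" unfolding Q_def by blast
    show "scale k u \<in> Q" for k unfolding Q_def using bs by (auto simp: g_scale)
    fix v assume "v \<in> Q"
    then obtain cs where cs: "a \<notin> set cs" "g cs v = 0" unfolding Q_def by blast
    have "g (bs @ cs) (u + v) = 0"
      using bs cs g_comm[of bs cs u] by (simp add: g_append g_add g_zero)
    then show "u + v \<in> Q" unfolding Q_def using bs cs by (intro CollectI exI[of _ "bs @ cs"]) auto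
  qed
  have "S - ?A \<subseteq> Q"
  proof
    fix s assume s: "s \<in> S - ?A"
    then obtain b where b: "f s = scale b s" using S by blast
    then have "b \<noteq> a" using s by blast
    then show "s \<in> Q" unfolding Q_def using b by (auto intro!: exI[of _ "[b]"] simp: g_simps)
  qed
  then have spanQ: "span (S - ?A) \<subseteq> Q" using Q_sub span_minimal by blast
  have "S = ?A \<union> (S - ?A)" by blast
  then obtain y z where yz: "x = y + z" "y \<in> span ?A" "z \<in> span (S - ?A)"
    using x(1) span_Un[of ?A "S - ?A"] by auto
  have "f y = scale a y" using yz(2)
  proof (induction rule: span_induct_alt)
    case (step c s u)
    then show ?case by (simp add: f.add f.scale scale_right_distrib mult.commute)
  qed simp
  then have fz: "f z = scale a z" using x(2) yz(1) by (simp add: f.add scale_right_distrib)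
  obtain bs where bs: "a \<notin> set bs" "g bs z = 0" using yz(3) spanQ unfolding Q_def by blast
  have "prod_list (map (\<lambda>b. a - b) bs) \<noteq> 0" using bs(1) by (induction bs) auto
  then have "z = 0" using bs(2) g_eig[OF fz, of bs] by simp
  then show ?thesis using yz by simp
qed

end

subsection \<open>Eigenvectors in countable dimension\<close>

locale complex_vector_space = vector_space scale
  for scale :: "complex \<Rightarrow> 'v::ab_group_add \<Rightarrow> 'v"
begin

definition poly_op :: "('v \<Rightarrow> 'v) \<Rightarrow> complex poly \<Rightarrow> 'v \<Rightarrow> 'v" where
  "poly_op f p v = (\<Sum>i\<le>degree p. scale (coeff p i) ((f ^^ i) v))"

lemma poly_op_eq_sum:
  assumes "degree p \<le> n"
  shows "poly_op f p v = (\<Sum>i\<le>n. scale (coeff p i) ((f ^^ i) v))"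
  unfolding poly_op_def using assms
  by (intro sum.mono_neutral_left) (auto simp: coeff_eq_0)

lemma poly_op_zero [simp]: "poly_op f 0 v = 0"
  by (simp add: poly_op_def)

lemma poly_op_const [simp]: "poly_op f [:a:] v = scale a v"
  by (simp add: poly_op_def)

lemma poly_op_add: "poly_op f (p + q) v = poly_op f p v + poly_op f q v"
proof -
  let ?n = "max (degree p) (degree q)"
  show ?thesis
    using degree_add_le_max[of p q]
    by (simp add: poly_op_eq_sum[of _ ?n] scale_left_distrib sum.distrib)
qed

lemma poly_op_smult: "poly_op f (smult a p) v = scale a (poly_op f p v)"
  using degree_smult_le[of a p]
  by (simp add: poly_op_eq_sum[of _ "degree p"] scale_sum_right)

lemma poly_op_shift:
  assumes "Vector_Spaces.linear scale scale f"
  shows "poly_op f (pCons 0 p) v = f (poly_op f p v)"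
proof -
  interpret f: Vector_Spaces.linear scale scale f by fact
  have "poly_op f (pCons 0 p) v = (\<Sum>i\<le>Suc (degree p). scale (coeff (pCons 0 p) i) ((f ^^ i) v))"
    by (rule poly_op_eq_sum) (simp add: degree_pCons_le)
  also have "\<dots> = (\<Sum>i\<le>degree p. scale (coeff p i) ((f ^^ Suc i) v))"
    by (subst sum.atMost_Suc_shift) simp
  finally show ?thesis by (simp add: poly_op_def f.sum f.scale)
qed

lemma poly_op_linear_factor:
  assumes "Vector_Spaces.linear scale scale f"
  shows "poly_op f ([:- a, 1:] * p) v = f (poly_op f p v) - scale a (poly_op f p v)"
proof -
  have "[:- a, 1:] * p = pCons 0 p + smult (- a) p" by simp
  then show ?thesis by (simp only: poly_op_add poly_op_smult poly_op_shift[OF assms]) simp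
qed

lemma poly_op_mem:
  assumes "subspace E" "\<And>v. v \<in> E \<Longrightarrow> f v \<in> E" "v \<in> E"
  shows "poly_op f p v \<in> E"
proof -
  have "(f ^^ i) v \<in> E" for i by (induction i) (use assms in auto)
  then show ?thesis unfolding poly_op_def using assms(1)
    by (intro subspace_sum) (auto intro: subspace_scale)
qed

text \<open>The fundamental theorem of algebra: peel linear factors off an annihilating polynomial until
  the remaining factor no longer annihilates \<open>v\<close>.\<close>

lemma eigenvector_if_poly_op_zero:
  assumes lin: "Vector_Spaces.linear scale scale f"
    and E: "subspace E" "\<And>v. v \<in> E \<Longrightarrow> f v \<in> E" and v: "v \<in> E" "v \<noteq> 0"
    and p: "p \<noteq> 0" "poly_op f p v = 0"
  shows "\<exists>a. \<exists>u\<in>E. u \<noteq> 0 \<and> f u = scale a u"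
  using p
proof (induction "degree p" arbitrary: p rule: less_induct)
  case less
  show ?case
  proof (cases "degree p = 0")
    case True
    then obtain a where "p = [:a:]" by (meson degree_eq_zeroE)
    then show ?thesis using less.prems v by simp
  next
    case False
    then obtain a where "poly p a = 0"
      using fundamental_theorem_of_algebra[of p] constant_degree[of p] by auto
    then obtain q where q: "p = [:- a, 1:] * q" by (metis dvdE poly_eq_0_iff_dvd)
    have q0: "q \<noteq> 0" using q less.prems(1) by auto
    show ?thesis
    proof (cases "poly_op f q v = 0")
      case True
      have "degree p = Suc (degree q)" using q q0 degree_mult_eq[of "[:- a, 1:]" q] by simp
      then show ?thesis using less.hyps[of q] q0 True by simp
    next
      case False
      moreover have "f (poly_op f q v) = scale a (poly_op f q v)"
        using less.prems(2) unfolding q poly_op_linear_factor[OF lin] by simp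
      moreover have "poly_op f q v \<in> E" using E v(1) by (rule poly_op_mem)
      ultimately show ?thesis by (intro exI bexI conjI)
    qed
  qed
qed

text \<open>Dixmier's argument. If \<open>f\<close> had no eigenvector in \<open>E\<close>, the vectors \<open>(f - t)\<^sup>-\<^sup>1 e\<close> for the
  uncountably many scalars \<open>t\<close> would satisfy a linear relation. Clearing denominators turns it into
  a nonzero polynomial in \<open>f\<close> that kills \<open>e\<close>, which produces an eigenvector after all.\<close>

lemma eigenvector_if_countable_dim:
  assumes lin: "Vector_Spaces.linear scale scale f"
    and E: "subspace E" "\<And>v. v \<in> E \<Longrightarrow> f v \<in> E" "E \<noteq> {0}"
    and S: "countable S" "E \<subseteq> span S"
    and surj: "\<And>a. (\<And>u. u \<in> E \<Longrightarrow> f u = scale a u \<Longrightarrow> u = 0) \<Longrightarrow> E \<subseteq> (\<lambda>u. f u - scale a u) ` E"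
  shows "\<exists>a. \<exists>u\<in>E. u \<noteq> 0 \<and> f u = scale a u"
proof (rule ccontr)
  interpret f: Vector_Spaces.linear scale scale f by fact
  assume no: "\<not> ?thesis"
  obtain e where e: "e \<in> E" "e \<noteq> 0" using E(1,3) subspace_0 by blast
  have "\<exists>u\<in>E. f u - scale a u = e" for a using surj[of a] no e(1) by blast
  then obtain r where r: "\<And>a. r a \<in> E" "\<And>a. f (r a) = scale a (r a) + e"
    by (metis add.commute diff_eq_eq)
  have poly0: "p = 0" if "poly_op f p e = 0" for p
    using eigenvector_if_poly_op_zero[OF lin E(1,2) e] no that by blast
  have indep: "p = 0 \<and> (\<forall>a\<in>A. b a = 0)"
    if "finite A" "poly_op f p e + (\<Sum>a\<in>A. scale (b a) (r a)) = 0" for A b p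
    using that
  proof (induction A arbitrary: b p rule: finite_induct)
    case empty
    then show ?case using poly0 by simp
  next
    case (insert c A)
    \<comment> \<open>Applying \<open>f - c\<close> removes the summand \<open>r c\<close>, since \<open>(f - c) (r a) = e + (a - c) (r a)\<close>.\<close>
    let ?q = "[:- c, 1:] * p + [:\<Sum>a\<in>insert c A. b a:]"
    have *: "f (\<Sum>a\<in>A. scale (b a) (r a)) = (\<Sum>a\<in>A. scale (b a * a) (r a)) + scale (\<Sum>a\<in>A. b a) e"
      by (simp add: f.sum f.scale r scale_right_distrib sum.distrib scale_sum_left)
    have q: "poly_op f ?q e = f (poly_op f p e) - scale c (poly_op f p e)
        + (scale (b c) e + scale (\<Sum>a\<in>A. b a) e)"
      using insert.hyps by (simp only: poly_op_add poly_op_linear_factor[OF lin] poly_op_const)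
        (simp add: scale_left_distrib)
    have s: "(\<Sum>a\<in>A. scale (b a * (a - c)) (r a))
        = (\<Sum>a\<in>A. scale (b a * a) (r a)) - scale c (\<Sum>a\<in>A. scale (b a) (r a))"
      by (simp add: right_diff_distrib scale_left_diff_distrib sum_subtractf scale_sum_right
          mult.commute)
    have P: "poly_op f p e = - scale (b c) (r c) - (\<Sum>a\<in>A. scale (b a) (r a))"
      using insert.prems insert.hyps by (simp add: algebra_simps eq_neg_iff_add_eq_0)
    have "poly_op f ?q e + (\<Sum>a\<in>A. scale (b a * (a - c)) (r a)) = 0"
      unfolding q s P
      by (simp add: f.diff f.neg * f.scale r scale_right_distrib scale_right_diff_distrib
          mult.commute)
    then have IH: "?q = 0" "\<forall>a\<in>A. b a * (a - c) = 0" using insert.IH[of ?q "\<lambda>a. b a * (a - c)"] by blast+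
    have bA: "\<forall>a\<in>A. b a = 0" using IH(2) insert.hyps(2) by auto
    have "p = 0"
    proof (rule ccontr)
      assume "p \<noteq> 0"
      then have "degree ([:- c, 1:] * p) = Suc (degree p)" by (subst degree_mult_eq) auto
      then have "degree ?q = Suc (degree p)" by (subst degree_add_eq_left) auto
      then show False using IH(1) by (metis degree_0 nat.distinct(1))
    qed
    then show ?case using IH(1) bA insert.hyps by (simp add: sum.insert)
  qed
  have inj_r: "a = b" if "r a = r b" for a b
  proof (rule ccontr)
    assume "a \<noteq> b"
    then show False
      using indep[of "{a, b}" 0 "\<lambda>x. if x = a then 1 else -1"] that by (auto split: if_splits)
  qed
  \<comment> \<open>A line of real scalars is enough; it is uncountable, so infinitely many of the vectors lie in one finite-dimensional span.\<close>
  have "(UNIV :: real set) = (\<Union>F\<in>{F. finite F \<and> F \<subseteq> S}. {t. r (of_real t) \<in> span F})"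
  proof -
    have "\<exists>F. finite F \<and> F \<subseteq> S \<and> r (of_real t) \<in> span F" for t
    proof -
      have "r (of_real t) \<in> span S" using r(1) S(2) by blast
      then obtain F u where "finite F" "F \<subseteq> S" "r (of_real t) = (\<Sum>a\<in>F. scale (u a) a)"
        unfolding span_explicit by blast
      then show ?thesis by (auto intro!: exI[of _ F] span_sum span_scale intro: span_base)
    qed
    then show ?thesis by auto
  qed
  moreover have "countable {F. finite F \<and> F \<subseteq> S}"
    using countable_Collect_finite_subset[OF S(1)] by (simp add: conj_commute)
  ultimately have "\<not> (\<forall>F\<in>{F. finite F \<and> F \<subseteq> S}. countable {t::real. r (of_real t) \<in> span F})"
    using uncountable_UNIV_real
    by (metis (no_types, lifting) countable_UN)
  then obtain F where F: "finite F" "uncountable {t::real. r (of_real t) \<in> span F}"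
    by blast
  then have "infinite {t::real. r (of_real t) \<in> span F}" using countable_finite by blast
  then obtain T where T: "T \<subseteq> {t::real. r (of_real t) \<in> span F}" "finite T" "card T = Suc (card F)"
    using infinite_arbitrarily_large by blast
  let ?h = "\<lambda>t::real. r (of_real t)"
  have inj: "inj_on ?h T" by (auto intro!: inj_onI dest: inj_r)
  have "independent (?h ` T)"
  proof (rule independent_if_scalars_zero)
    fix u x assume u: "(\<Sum>x\<in>?h ` T. scale (u x) x) = 0" and x: "x \<in> ?h ` T"
    have "(\<Sum>a\<in>of_real ` T. scale (u (r a)) (r a)) = (\<Sum>x\<in>?h ` T. scale (u x) x)"
      using inj by (simp add: sum.reindex inj_on_def)
    then have "\<forall>a\<in>of_real ` T. u (r a) = 0"
      using indep[of "of_real ` T" 0 "\<lambda>a. u (r a)"] u T(2) by simp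
    then show "u x = 0" using x by auto
  qed (use T in auto)
  then have "card (?h ` T) \<le> card F"
    using independent_span_bound[OF F(1)] T(1) by blast
  then show False using card_image[OF inj] T(3) by simp
qed

end


section \<open>Irreducible modules with an infinite-dimensional weight space\<close>

text \<open>An irreducible \<open>W(2,2)\<close>-module, seen through the operators \<open>X n\<close> of \<open>x\<^sub>n\<close> and \<open>J n\<close> of \<open>I(n)\<close>. The
  central elements appear only as scalars \<open>c\<close> and \<open>c1\<close>. Working with bare operators makes the
  automorphism \<open>x\<^sub>n \<mapsto> - x\<^bsub>-n\<^esub>\<close>, \<open>I(n) \<mapsto> - I(-n)\<close> of the algebra available as a second interpretation
  of the same locale.\<close>

locale w22_rep = complex_vector_space scale
  for scale :: "complex \<Rightarrow> 'v::ab_group_add \<Rightarrow> 'v" +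
  fixes X J :: "int \<Rightarrow> 'v \<Rightarrow> 'v" and c c1 :: complex
  assumes X_linear: "Vector_Spaces.linear scale scale (X n)"
    and J_linear: "Vector_Spaces.linear scale scale (J n)"
    and XX: "X n (X m v) = X m (X n v) + scale (of_int (m - n)) (X (n + m) v)
        + scale (w22_cocycle n m * c) v"
    and XJ: "X n (J m v) = J m (X n v) + scale (of_int (m - n)) (J (n + m) v)
        + scale (w22_cocycle n m * c1) v"
    and JJ: "J n (J m v) = J m (J n v)"
    and irred: "subspace W \<Longrightarrow> (\<And>n w. w \<in> W \<Longrightarrow> X n w \<in> W) \<Longrightarrow> (\<And>n w. w \<in> W \<Longrightarrow> J n w \<in> W)
        \<Longrightarrow> W = {0} \<or> W = UNIV"
    and countable_dim: "\<exists>S. countable S \<and> span S = UNIV"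
    and infinite_wt: "\<exists>\<nu>. infinite_dim {v. X 0 v = scale \<nu> v}"
begin

abbreviation wt :: "complex \<Rightarrow> 'v set" where
  "wt \<nu> \<equiv> {v. X 0 v = scale \<nu> v}"

lemma linear_ops [simp]:
  "X n (u + v) = X n u + X n v" "X n (u - v) = X n u - X n v" "X n (- v) = - X n v"
  "X n 0 = 0" "X n (scale a v) = scale a (X n v)"
  "J n (u + v) = J n u + J n v" "J n (u - v) = J n u - J n v" "J n (- v) = - J n v"
  "J n 0 = 0" "J n (scale a v) = scale a (J n v)"
proof -
  interpret X: Vector_Spaces.linear scale scale "X n" by (rule X_linear)
  interpret J: Vector_Spaces.linear scale scale "J n" by (rule J_linear)
  show "X n (u + v) = X n u + X n v" "X n (u - v) = X n u - X n v" "X n (- v) = - X n v"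
    "X n 0 = 0" "X n (scale a v) = scale a (X n v)"
    "J n (u + v) = J n u + J n v" "J n (u - v) = J n u - J n v" "J n (- v) = - J n v"
    "J n 0 = 0" "J n (scale a v) = scale a (J n v)"
    by (simp_all add: X.add X.diff X.neg X.zero X.scale J.add J.diff J.neg J.zero J.scale)
qed

lemma JX: "J n (X m v) = X m (J n v) + scale (of_int (m - n)) (J (n + m) v)
    + scale (w22_cocycle n m * c1) v"
proof -
  have "scale (of_int (m - n)) u = - scale (of_int (n - m)) u"
    "scale (w22_cocycle n m * c1) u = - scale (w22_cocycle m n * c1) u" for u
    by (simp_all add: w22_cocycle_skew[of n m] flip: scale_minus_left)
  then show ?thesis by (simp add: XJ[of m n] add.commute)
qed

text \<open>The symmetry that exchanges highest and lowest weight vectors. It negates weights and central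
  charges, and the main steps below are applied on both sides of it.\<close>

lemma mirror: "w22_rep scale (\<lambda>n v. - X (- n) v) (\<lambda>n v. - J (- n) v) (- c) (- c1)"
proof -
  have cocycle: "w22_cocycle (- n) (- m) = - w22_cocycle n m" for n m
    by (auto simp: w22_cocycle_def field_simps)
  have neg: "Vector_Spaces.linear scale scale (\<lambda>v. - f v)"
    if "Vector_Spaces.linear scale scale f" for f
  proof -
    interpret f: Vector_Spaces.linear scale scale f by fact
    show ?thesis by unfold_locales (simp_all add: f.add f.scale)
  qed
  have wt_neg: "{v. - X (- 0) v = scale \<nu> v} = wt (- \<nu>)" for \<nu>
    by (simp only: minus_zero scale_minus_left) (metis minus_minus)
  show ?thesis
  proof unfold_locales
    fix n m v
    show "- X (- n) (- X (- m) v) = - X (- m) (- X (- n) v)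
        + scale (of_int (m - n)) (- X (- (n + m)) v) + scale (w22_cocycle n m * - c) v"
      by (subst linear_ops, subst XX) (simp add: cocycle scale_left_diff_distrib)
    show "- X (- n) (- J (- m) v) = - J (- m) (- X (- n) v)
        + scale (of_int (m - n)) (- J (- (n + m)) v) + scale (w22_cocycle n m * - c1) v"
      by (subst linear_ops, subst XJ) (simp add: cocycle scale_left_diff_distrib)
    show "- J (- n) (- J (- m) v) = - J (- m) (- J (- n) v)"
      by (simp add: JJ)
  next
    fix W assume W: "subspace W" "\<And>n w. w \<in> W \<Longrightarrow> - X (- n) w \<in> W"
      "\<And>n w. w \<in> W \<Longrightarrow> - J (- n) w \<in> W"
    show "W = {0} \<or> W = UNIV"
    proof (rule irred)
      show "X n w \<in> W" if "w \<in> W" for n w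
        using subspace_neg[OF W(1) W(2)[OF that, of "- n"]] by simp
      show "J n w \<in> W" if "w \<in> W" for n w
        using subspace_neg[OF W(1) W(3)[OF that, of "- n"]] by simp
    qed fact
  next
    show "\<exists>S. countable S \<and> span S = UNIV" by (rule countable_dim)
  next
    show "\<exists>\<nu>. infinite_dim {v. - X (- 0) v = scale \<nu> v}"
      unfolding wt_neg using infinite_wt by (metis minus_minus)
  qed (use neg X_linear J_linear Vector_Spaces.linear_iff in auto)
qed

lemma subspace_wt: "subspace (wt \<nu>)"
  by (simp add: subspace_def scale_right_distrib mult.commute)

lemma X_wt:
  assumes "v \<in> wt \<nu>"
  shows "X n v \<in> wt (\<nu> + of_int n)"
proof -
  have "w22_cocycle 0 n = 0" by (simp add: w22_cocycle_def)
  then show ?thesis using assms by (simp add: XX[of 0 n] scale_left_distrib)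
qed

lemma J_wt:
  assumes "v \<in> wt \<nu>"
  shows "J n v \<in> wt (\<nu> + of_int n)"
proof -
  have "w22_cocycle 0 n = 0" by (simp add: w22_cocycle_def)
  then show ?thesis using assms by (simp add: XJ[of 0 n] scale_left_distrib)
qed

lemma span_submodule:
  assumes "\<And>n s. s \<in> S \<Longrightarrow> X n s \<in> span S" "\<And>n s. s \<in> S \<Longrightarrow> J n s \<in> span S"
    and "s \<in> S" "s \<noteq> 0"
  shows "span S = UNIV"
proof -
  have "span S = {0} \<or> span S = UNIV"
    by (rule irred) (use assms span_invariant[OF X_linear, of _ S S]
        span_invariant[OF J_linear, of _ S S] in \<open>auto simp: image_subset_iff\<close>)
  then show ?thesis using assms(3,4) span_base by blast
qed

lemma wt_subset_span:
  assumes "span S = UNIV" "\<And>s. s \<in> S \<Longrightarrow> \<exists>\<nu>. s \<in> wt \<nu>"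
  shows "wt \<nu> \<subseteq> span (S \<inter> wt \<nu>)"
proof
  fix x assume "x \<in> wt \<nu>"
  then have "x \<in> span {s\<in>S. X 0 s = scale \<nu> s}"
    using eigenspace_of_span[OF X_linear[of 0], of S x \<nu>] assms by auto
  then show "x \<in> span (S \<inter> wt \<nu>)" by (simp add: Collect_conj_eq Int_commute Collect_mem_eq)
qed


section \<open>Highest weight vectors\<close>

text \<open>\<open>[x\<^sub>1, x\<^sub>n] = (n - 1) x\<^bsub>n+1\<^esub>\<close> and \<open>[x\<^sub>1, I(n)] = (n - 1) I(n+1)\<close>, so degrees 1 and 2 generate everything
  of positive degree.\<close>

lemma positive_part_kills:
  assumes "X 1 v = 0" "X 2 v = 0" "J 1 v = 0" "J 2 v = 0" and "n \<ge> 1"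
  shows "X n v = 0 \<and> J n v = 0"
  using \<open>n \<ge> 1\<close>
proof (induction n rule: int_ge_induct)
  case (step n)
  show ?case
  proof (cases "n = 1")
    case False
    then have "w22_cocycle 1 n = 0" "(of_int (n - 1) :: complex) \<noteq> 0"
      using step.hyps by (auto simp: w22_cocycle_def)
    then show ?thesis
      using XX[of 1 n v] XJ[of 1 n v] step.IH assms(1) by (simp add: add.commute)
  qed (use assms in simp)
qed (use assms in simp)

text \<open>The piece of degree \<open>-i\<close> of the submodule generated by a space \<open>E\<close> of highest weight vectors that
  is stable under \<open>I(0)\<close>. Only lowering operators are used to build it; that raising operators
  preserve it is a theorem. Negative \<open>i\<close> are admitted, with only the zero vector in them, so that
  raising beyond \<open>E\<close> needs no case distinction.\<close>

inductive descend :: "'v set \<Rightarrow> int \<Rightarrow> 'v \<Rightarrow> bool" for E where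
  base: "v \<in> E \<Longrightarrow> descend E 0 v"
| zero: "descend E i 0"
| add: "descend E i u \<Longrightarrow> descend E i v \<Longrightarrow> descend E i (u + v)"
| scale: "descend E i v \<Longrightarrow> descend E i (scale a v)"
| X: "k > 0 \<Longrightarrow> descend E i v \<Longrightarrow> descend E (i + k) (X (- k) v)"
| J: "k > 0 \<Longrightarrow> descend E i v \<Longrightarrow> descend E (i + k) (J (- k) v)"

lemma descend_neg:
  assumes "descend E i v" "i < 0"
  shows "v = 0"
  using assms by (induction rule: descend.induct) auto

lemma descend_0:
  assumes "descend E i v" "i = 0" "subspace E"
  shows "v \<in> E"
  using assms
proof (induction rule: descend.induct)
  case (X k i v)
  then show ?case using descend_neg[of E i v] subspace_0 by auto
next
  case (J k i v)
  then show ?case using descend_neg[of E i v] subspace_0 by auto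
qed (auto simp: subspace_def)

lemma descend_wt:
  assumes "descend E i v" "E \<subseteq> wt \<nu>"
  shows "v \<in> wt (\<nu> - of_int i)"
  using assms
proof (induction rule: descend.induct)
  case (add i u v)
  then show ?case by (simp add: scale_right_distrib)
next
  case (scale i v a)
  then show ?case by (simp add: mult.commute)
next
  case (X k i v)
  then show ?case using X_wt[of v "\<nu> - of_int i" "- k"] by (simp add: algebra_simps)
next
  case (J k i v)
  then show ?case using J_wt[of v "\<nu> - of_int i" "- k"] by (simp add: algebra_simps)
qed auto

text \<open>Commute the raising operator past the outermost lowering operator. The commutator has a degree
  in between, so it is either a lowering operator or covered by the induction hypothesis, which is
  therefore needed for all \<open>j\<close> at once.\<close>

lemma descend_ascending:
  assumes "descend E i v" and E: "subspace E" "E \<subseteq> wt \<nu>" "\<And>v. v \<in> E \<Longrightarrow> J 0 v \<in> E"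
    and kill: "\<And>v n. v \<in> E \<Longrightarrow> n \<ge> 1 \<Longrightarrow> X n v = 0 \<and> J n v = 0"
  shows "j \<ge> 0 \<Longrightarrow> descend E (i - j) (X j v) \<and> descend E (i - j) (J j v)"
  using assms(1)
proof (induction arbitrary: j rule: descend.induct)
  case (base v)
  show ?case
  proof (cases "j = 0")
    case True
    then show ?thesis
      using base E subspace_scale[OF E(1) base(1), of \<nu>] by (auto intro!: descend.base)
  qed (use base kill[of v j] in \<open>auto intro: descend.zero\<close>)
next
  case (X k i v)
  have *: "descend E (i + k - j) (X (j - k) v) \<and> descend E (i + k - j) (J (j - k) v)"
  proof (cases "j \<ge> k")
    case True
    then show ?thesis using X.IH[of "j - k"] by (simp add: algebra_simps)
  next
    case False
    then show ?thesis
      using descend.X[of "k - j" E i v] descend.J[of "k - j" E i v] X.hyps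
      by (simp add: algebra_simps)
  qed
  have c: "descend E (i + k - j) (scale (w22_cocycle j (- k) * a) v)" for a
    using descend.scale[OF X.hyps(2)] descend.zero[of E] by (auto simp: w22_cocycle_def)
  have "descend E (i - j + k) (X (- k) (X j v))" "descend E (i - j + k) (X (- k) (J j v))"
    using descend.X[OF X.hyps(1)] X.IH[OF X.prems] by blast+
  then have **: "descend E (i + k - j) (X (- k) (X j v))" "descend E (i + k - j) (X (- k) (J j v))"
    by (simp_all add: algebra_simps)
  have 1: "descend E (i + k - j) (X j (X (- k) v))"
    using * by (subst XX) (auto intro!: descend.add descend.scale ** c)
  have 2: "descend E (i + k - j) (J j (X (- k) v))"
    using * by (subst JX) (auto intro!: descend.add descend.scale ** c)
  show ?case using 1 2 by simp
next
  case (J k i v)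
  have *: "descend E (i + k - j) (J (j - k) v)"
  proof (cases "j \<ge> k")
    case True
    then show ?thesis using J.IH[of "j - k"] by (simp add: algebra_simps)
  next
    case False
    then show ?thesis
      using descend.J[of "k - j" E i v] J.hyps by (simp add: algebra_simps)
  qed
  have c: "descend E (i + k - j) (scale (w22_cocycle j (- k) * a) v)" for a
    using descend.scale[OF J.hyps(2)] descend.zero[of E] by (auto simp: w22_cocycle_def)
  have "descend E (i - j + k) (J (- k) (X j v))" "descend E (i - j + k) (J (- k) (J j v))"
    using descend.J[OF J.hyps(1)] J.IH[OF J.prems] by blast+
  then have **: "descend E (i + k - j) (J (- k) (X j v))" "descend E (i + k - j) (J (- k) (J j v))"
    by (simp_all add: algebra_simps)
  have 1: "descend E (i + k - j) (X j (J (- k) v))"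
    using * by (subst XJ) (auto intro!: descend.add descend.scale ** c)
  have 2: "descend E (i + k - j) (J j (J (- k) v))"
    using ** by (simp add: JJ[of j])
  show ?case using 1 2 by simp
qed (auto intro: descend.add descend.scale descend.zero)

text \<open>Degree \<open>-n\<close> is reached from the finitely many degrees above it by finitely many operators.\<close>

lemma descend_finite_dim:
  assumes "finite B" "E \<subseteq> span B"
  shows "\<exists>B. finite B \<and> {v. descend E (int n) v} \<subseteq> span B"
proof (induction n rule: less_induct)
  case (less n)
  then obtain D where D: "\<And>m. m < n \<Longrightarrow> finite (D m) \<and> {v. descend E (int m) v} \<subseteq> span (D m)"
    by metis
  let ?B = "B \<union> (\<Union>m<n. X (int m - int n) ` D m \<union> J (int m - int n) ` D m)"
  have "v \<in> span ?B" if "descend E i v" "i = int n" for i v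
    using that
  proof (induction rule: descend.induct)
    case (base v)
    then show ?case using assms(2) span_mono[of B ?B] by blast
  next
    case (X k i v)
    show ?case
    proof (cases "i < 0")
      case False
      then obtain m where m: "i = int m" "- k = int m - int n" "m < n"
        using X.hyps(1) X.prems by (metis add_diff_cancel_left' diff_add_cancel
            int_eq_iff less_add_same_cancel1 linorder_not_less minus_diff_eq of_nat_less_iff)
      have "X (int m - int n) v \<in> span ?B"
      proof (rule span_invariant[OF X_linear, of _ "D m"])
        show "X (int m - int n) ` D m \<subseteq> span ?B"
          using m(3) span_superset[of ?B] by blast
        show "v \<in> span (D m)" using D[OF m(3)] X.hyps m(1) by blast
      qed
      then show ?thesis using m by simp
    qed (use descend_neg X.hyps span_zero in force)
  next
    case (J k i v)
    show ?case
    proof (cases "i < 0")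
      case False
      then obtain m where m: "i = int m" "- k = int m - int n" "m < n"
        using J.hyps(1) J.prems by (metis add_diff_cancel_left' diff_add_cancel
            int_eq_iff less_add_same_cancel1 linorder_not_less minus_diff_eq of_nat_less_iff)
      have "J (int m - int n) v \<in> span ?B"
      proof (rule span_invariant[OF J_linear, of _ "D m"])
        show "J (int m - int n) ` D m \<subseteq> span ?B"
          using m(3) span_superset[of ?B] by blast
        show "v \<in> span (D m)" using D[OF m(3)] J.hyps m(1) by blast
      qed
      then show ?thesis using m by simp
    qed (use descend_neg J.hyps span_zero in force)
  qed (auto intro: span_add span_scale span_zero)
  moreover have "finite ?B" using assms(1) D by auto
  ultimately show ?case by blast
qed

lemma descend_span_UNIV:
  assumes E: "subspace E" "E \<subseteq> wt \<nu>" "\<And>v. v \<in> E \<Longrightarrow> J 0 v \<in> E" "E \<noteq> {0}"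
    and kill: "\<And>v n. v \<in> E \<Longrightarrow> n \<ge> 1 \<Longrightarrow> X n v = 0 \<and> J n v = 0"
  shows "span {v. \<exists>i. descend E i v} = UNIV"
proof -
  obtain e where "e \<in> E" "e \<noteq> 0" using E(1,4) subspace_0 by blast
  show ?thesis
  proof (rule span_submodule)
    fix n s assume "s \<in> {v. \<exists>i. descend E i v}"
    then obtain i where i: "descend E i s" by blast
    have "descend E (i - n) (X n s) \<and> descend E (i - n) (J n s)"
    proof (cases "n \<ge> 0")
      case True
      then show ?thesis using descend_ascending[OF i E(1,2,3) kill] by blast
    next
      case False
      then show ?thesis using descend.X[of "- n", OF _ i] descend.J[of "- n", OF _ i] by simp
    qed
    then show "X n s \<in> span {v. \<exists>i. descend E i v}" "J n s \<in> span {v. \<exists>i. descend E i v}"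
      by (auto intro: span_base)
  next
    show "e \<in> {v. \<exists>i. descend E i v}" using \<open>e \<in> E\<close> descend.base by blast
    show "e \<noteq> 0" by fact
  qed
qed

text \<open>Irreducibility makes the space \<open>E\<close> of highest weight vectors of weight \<open>\<nu>\<close> irreducible under \<open>I(0)\<close>,
  because the submodule generated by an \<open>I(0)\<close>-stable subspace has that same subspace as its top
  weight space. Hence \<open>I(0)\<close>, which need not act semisimply, has an eigenvector in \<open>E\<close>. The module it
  generates has a one-dimensional top and so only finite-dimensional weight spaces.\<close>

lemma no_highest_weight_vector:
  assumes v: "v \<in> wt \<nu>" "X 1 v = 0" "X 2 v = 0" "J 1 v = 0" "J 2 v = 0"
  shows "v = 0"
proof (rule ccontr)
  assume "v \<noteq> 0"
  define E where "E = {u \<in> wt \<nu>. X 1 u = 0 \<and> X 2 u = 0 \<and> J 1 u = 0 \<and> J 2 u = 0}"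
  have kill: "X n u = 0 \<and> J n u = 0" if "u \<in> E" "n \<ge> 1" for n u
    using positive_part_kills that unfolding E_def by blast
  have E: "subspace E" "E \<subseteq> wt \<nu>" "v \<in> E"
    using v unfolding E_def by (auto simp: subspace_def scale_right_distrib mult.commute)
  have J0: "J 0 u \<in> E" if "u \<in> E" for u
    using J_wt[of u \<nu> 0] that kill[OF that]
    unfolding E_def by (simp add: JJ[of _ 0] XJ[of _ 0] w22_cocycle_def)
  have top: "wt \<nu> \<subseteq> F" if F: "subspace F" "F \<subseteq> E" "F \<noteq> {0}" "\<And>u. u \<in> F \<Longrightarrow> J 0 u \<in> F" for F
  proof -
    let ?S = "{v. \<exists>i. descend F i v}"
    have "span ?S = UNIV"
      by (rule descend_span_UNIV[of F \<nu>]) (use F E kill in auto)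
    then have "wt \<nu> \<subseteq> span (?S \<inter> wt \<nu>)"
      by (rule wt_subset_span) (use descend_wt[of F _ _ \<nu>] F E in blast)
    moreover have "?S \<inter> wt \<nu> \<subseteq> F"
    proof
      fix x assume x: "x \<in> ?S \<inter> wt \<nu>"
      then obtain i where i: "descend F i x" by blast
      then have "x \<in> wt (\<nu> - of_int i)" using descend_wt F E by blast
      then have "scale (of_int i) x = 0" using x by (simp add: scale_left_diff_distrib)
      then show "x \<in> F" using descend_0[OF i _ F(1)] subspace_0[OF F(1)] by auto
    qed
    ultimately show ?thesis using span_minimal[OF _ F(1)] by blast
  qed
  have "\<exists>a. \<exists>u\<in>E. u \<noteq> 0 \<and> J 0 u = scale a u"
  proof -
    obtain S where S: "countable S" "span S = UNIV" using countable_dim by blast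
    show ?thesis
    proof (rule eigenvector_if_countable_dim[OF J_linear E(1) J0 _ S(1)])
      show "E \<noteq> {0}" using E(3) \<open>v \<noteq> 0\<close> by blast
      show "E \<subseteq> span S" using S by simp
      fix a assume inj: "\<And>u. u \<in> E \<Longrightarrow> J 0 u = scale a u \<Longrightarrow> u = 0"
      let ?F = "(\<lambda>u. J 0 u - scale a u) ` E"
      have "wt \<nu> \<subseteq> ?F"
      proof (rule top)
        show "?F \<subseteq> E" using E(1) J0 by (auto intro!: subspace_diff subspace_scale)
        have "J 0 v - scale a v \<noteq> 0" using inj[OF E(3)] \<open>v \<noteq> 0\<close> by auto
        then show "?F \<noteq> {0}" using E(3) by blast
        show "J 0 u \<in> ?F" if "u \<in> ?F" for u
        proof -
          obtain e where e: "e \<in> E" "u = J 0 e - scale a e" using \<open>u \<in> ?F\<close> by blast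
          then have "J 0 u = J 0 (J 0 e) - scale a (J 0 e)" by simp
          then show ?thesis using J0[OF e(1)] by blast
        qed
        show "subspace ?F"
          unfolding subspace_def
        proof (intro conjI ballI allI)
          have "0 = J 0 0 - scale a 0" by simp
          then show "0 \<in> ?F" using subspace_0[OF E(1)] by blast
          fix x assume "x \<in> ?F"
          then obtain u where u: "u \<in> E" "x = J 0 u - scale a u" by blast
          have "scale b x = J 0 (scale b u) - scale a (scale b u)" for b
            using u by (simp add: scale_right_diff_distrib mult.commute)
          then show "scale b x \<in> ?F" for b using subspace_scale[OF E(1) u(1)] by blast
          fix y assume "y \<in> ?F"
          then obtain w where w: "w \<in> E" "y = J 0 w - scale a w" by blast
          have "x + y = J 0 (u + w) - scale a (u + w)"
            using u w by (simp add: scale_right_distrib)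
          then show "x + y \<in> ?F" using subspace_add[OF E(1) u(1) w(1)] by blast
        qed
      qed
      then show "E \<subseteq> ?F" using E(2) by blast
    qed
  qed
  then obtain a u where u: "u \<in> E" "u \<noteq> 0" "J 0 u = scale a u" by blast
  define F where "F = span {u}"
  have F: "subspace F" "F \<subseteq> E" "F \<noteq> {0}"
    using u E(1) span_base[of u "{u}"] span_minimal[of "{u}" E] unfolding F_def by auto
  have J0F: "J 0 x \<in> F" if "x \<in> F" for x
    using span_invariant[OF J_linear, of 0 "{u}" "{u}" x] that u(3)
    unfolding F_def by (auto intro: span_scale span_base)
  let ?S = "{v. \<exists>i. descend F i v}"
  have S: "span ?S = UNIV"
    by (rule descend_span_UNIV[of F \<nu>]) (use F E kill J0F in auto)
  have "\<not> infinite_dim (wt \<rho>)" for \<rho>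
  proof -
    have "\<exists>B. finite B \<and> ?S \<inter> wt \<rho> \<subseteq> span B"
    proof (cases "\<exists>n. \<rho> = \<nu> - of_nat n")
      case True
      then obtain n where n: "\<rho> = \<nu> - of_nat n" by blast
      obtain B where B: "finite B" "{v. descend F (int n) v} \<subseteq> span B"
        using descend_finite_dim[of "{u}" F n] F_def by auto
      have "?S \<inter> wt \<rho> \<subseteq> span B"
      proof
        fix x assume x: "x \<in> ?S \<inter> wt \<rho>"
        then obtain i where i: "descend F i x" by blast
        then have "x \<in> wt (\<nu> - of_int i)" using descend_wt F E by blast
        then have "scale (of_int i - of_nat n) x = 0"
          using x n by (simp add: scale_left_diff_distrib)
        then have "x = 0 \<or> (of_int i :: complex) = of_int (int n)" by auto
        then show "x \<in> span B" using B(2) i span_zero by (auto simp only: of_int_eq_iff)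
      qed
      then show ?thesis using B by blast
    next
      case False
      have "x = 0" if x: "x \<in> ?S \<inter> wt \<rho>" for x
      proof -
        obtain i where i: "descend F i x" using x by blast
        show ?thesis
        proof (cases "i < 0")
          case False
          have "x \<in> wt (\<nu> - of_int i)" using descend_wt i F E by blast
          then have "scale (\<nu> - of_int i - \<rho>) x = 0" using x by (simp add: scale_left_diff_distrib)
          moreover have "\<nu> - of_int i - \<rho> \<noteq> 0"
            using \<open>\<not> (\<exists>n. \<rho> = \<nu> - of_nat n)\<close> False
            by (metis diff_diff_eq2 diff_eq_diff_eq diff_zero eq_iff_diff_eq_0 int_nat_eq
                linorder_not_less of_int_of_nat_eq)
          ultimately show ?thesis by auto
        qed (use descend_neg i in blast)
      qed
      then show ?thesis by (intro exI[of _ "{}"]) auto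
    qed
    then obtain B where B: "finite B" "?S \<inter> wt \<rho> \<subseteq> span B" by blast
    have "wt \<rho> \<subseteq> span (?S \<inter> wt \<rho>)"
      by (rule wt_subset_span[OF S]) (use descend_wt[of F _ _ \<nu>] F E in blast)
    then have "wt \<rho> \<subseteq> span B" using span_minimal[OF B(2)] by simp
    then show ?thesis using infinite_dim_iff[OF subspace_wt] B(1) by blast
  qed
  then show False using infinite_wt by blast
qed

lemma no_lowest_weight_vector:
  assumes "v \<in> wt \<nu>" "X (-1) v = 0" "X (-2) v = 0" "J (-1) v = 0" "J (-2) v = 0"
  shows "v = 0"
proof -
  interpret m: w22_rep scale "\<lambda>n v. - X (- n) v" "\<lambda>n v. - J (- n) v" "- c" "- c1"
    by (rule mirror)
  show ?thesis using m.no_highest_weight_vector[of v "- \<nu>"] assms by simp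
qed

section \<open>Generic vectors next to a finite-dimensional weight space\<close>

text \<open>Suppose the weight space of degree 0 is finite-dimensional. A vector of degree \<open>-s\<close> with
  \<open>s = 1\<close> or \<open>s = -1\<close> is generic when a fixed finite list of operators of total degree \<open>s\<close> kills it,
  namely those that jump over degree 0 at most \<open>n\<close> times, alternating between degrees \<open>-1\<close> and \<open>1\<close>,
  before landing in it.\<close>

primrec generic :: "nat \<Rightarrow> int \<Rightarrow> 'v \<Rightarrow> bool" where
  "generic 0 s v \<longleftrightarrow> X s v = 0 \<and> J s v = 0"
| "generic (Suc n) s v \<longleftrightarrow> X s v = 0 \<and> J s v = 0
     \<and> generic n (- s) (X (2 * s) v) \<and> generic n (- s) (J (2 * s) v)"

lemma generic_less: "generic (Suc n) s v \<Longrightarrow> generic n s v"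
proof (induction n arbitrary: s v)
  case (Suc n)
  then show ?case unfolding generic.simps(2)[of "Suc n"] generic.simps(2)[of n] by blast
qed simp

lemma generic_uminus [simp]: "generic n s (- v) \<longleftrightarrow> generic n s v"
  by (induction n arbitrary: s v) auto

lemma generic_mirror:
  "w22_rep.generic (\<lambda>n v. - X (- n) v) (\<lambda>n v. - J (- n) v) n s v \<longleftrightarrow> generic n (- s) v"
proof -
  interpret m: w22_rep scale "\<lambda>n v. - X (- n) v" "\<lambda>n v. - J (- n) v" "- c" "- c1"
    by (rule mirror)
  show ?thesis by (induction n arbitrary: s v) simp_all
qed

text \<open>Each condition is the kernel of a linear map into the finite-dimensional weight space, so
  infinitely many dimensions survive. The map \<open>f\<close> accounts for the steps already taken.\<close>

lemma generic_infinite: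
  assumes fin: "\<not> infinite_dim (wt \<mu>)" and "s = 1 \<or> s = - 1"
    and "subspace E" "infinite_dim E" "Vector_Spaces.linear scale scale f"
    and "f ` E \<subseteq> wt (\<mu> - of_int s)"
  shows "subspace {v\<in>E. generic n s (f v)} \<and> infinite_dim {v\<in>E. generic n s (f v)}"
  using assms(2-)
proof (induction n arbitrary: s E f)
  have comp: "Vector_Spaces.linear scale scale (\<lambda>v. X n (f v))"
    "Vector_Spaces.linear scale scale (\<lambda>v. J n (f v))"
    if "Vector_Spaces.linear scale scale f" for n f
  proof -
    interpret f: Vector_Spaces.linear scale scale f by fact
    show "Vector_Spaces.linear scale scale (\<lambda>v. X n (f v))"
      "Vector_Spaces.linear scale scale (\<lambda>v. J n (f v))"
      by (unfold_locales; simp add: f.add f.scale)+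
  qed
  have zero: "subspace {v\<in>E. generic 0 s (f v)} \<and> infinite_dim {v\<in>E. generic 0 s (f v)}"
    if E: "subspace E" "infinite_dim E" and f: "Vector_Spaces.linear scale scale f"
      and fE: "f ` E \<subseteq> wt (\<mu> - of_int s)" for s E f
  proof -
    let ?E1 = "{v\<in>E. X s (f v) = 0}"
    let ?E2 = "{v\<in>?E1. J s (f v) = 0}"
    have im: "X s (f v) \<in> wt \<mu> \<and> J s (f v) \<in> wt \<mu>" if "v \<in> E" for v
      using X_wt[of "f v" "\<mu> - of_int s" s] J_wt[of "f v" "\<mu> - of_int s" s] fE that by auto
    have 1: "subspace ?E1" "infinite_dim ?E1"
      using subspace_linear_kernel[OF E(1) comp(1)[OF f]]
        infinite_dim_kernel[OF E comp(1)[OF f] _ subspace_wt fin] im by auto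
    have 2: "subspace ?E2" "infinite_dim ?E2"
      using subspace_linear_kernel[OF 1(1) comp(2)[OF f]]
        infinite_dim_kernel[OF 1 comp(2)[OF f] _ subspace_wt fin] im by auto
    have "?E2 = {v\<in>E. generic 0 s (f v)}" by auto
    then show ?thesis using 2 by simp
  qed
  {
    case 0
    then show ?case using zero by blast
  next
    case (Suc n)
    let ?E2 = "{v\<in>E. generic 0 s (f v)}"
    let ?E3 = "{v\<in>?E2. generic n (- s) (X (2 * s) (f v))}"
    let ?E4 = "{v\<in>?E3. generic n (- s) (J (2 * s) (f v))}"
    have s: "- s = 1 \<or> - s = - 1" using Suc.prems by auto
    have im: "X (2 * s) (f v) \<in> wt (\<mu> - of_int (- s))" "J (2 * s) (f v) \<in> wt (\<mu> - of_int (- s))"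
      if "v \<in> E" for v
      using X_wt[of "f v" "\<mu> - of_int s" "2 * s"] J_wt[of "f v" "\<mu> - of_int s" "2 * s"]
        Suc.prems that by (auto simp: algebra_simps image_subset_iff)
    have 2: "subspace ?E2" "infinite_dim ?E2" using zero Suc.prems by blast+
    have 3: "subspace ?E3 \<and> infinite_dim ?E3"
      by (rule Suc.IH[OF s 2 comp(1)[OF Suc.prems(4)]]) (use im in blast)
    have 4: "subspace ?E4 \<and> infinite_dim ?E4"
      by (rule Suc.IH[OF s conjunct1[OF 3] conjunct2[OF 3] comp(2)[OF Suc.prems(4)]])
        (use im in blast)
    have "?E4 = {v\<in>E. generic (Suc n) s (f v)}" by auto
    then show ?case using 4 by simp
  }
qed

lemma generic_exists:
  assumes "\<not> infinite_dim (wt \<mu>)" "infinite_dim (wt (\<mu> - 1))"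
  obtains v where "v \<in> wt (\<mu> - 1)" "v \<noteq> 0" "generic n 1 v"
proof -
  have "Vector_Spaces.linear scale scale (\<lambda>v. v)" by unfold_locales auto
  then have "subspace {v\<in>wt (\<mu> - 1). generic n 1 v} \<and> infinite_dim {v\<in>wt (\<mu> - 1). generic n 1 v}"
    using generic_infinite[of \<mu> 1 "wt (\<mu> - 1)" "\<lambda>v. v" n] assms subspace_wt by auto
  then show ?thesis using infinite_dim_nonzero that by blast
qed


section \<open>Relations satisfied by generic vectors\<close>

lemma scale_collect:
  assumes "scale a p + scale b q = scale a' p + scale b' q"
  shows "scale (a - a') p = scale (b' - b) q"
  using assms by (simp add: scale_left_diff_distrib algebra_simps)

lemma scale_cancel_factor: "scale (a * b) p = scale (a * d) q \<Longrightarrow> a \<noteq> 0 \<Longrightarrow> scale b p = scale d q"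
  by (simp flip: scale_scale)

lemma cocycle_0: "n + m \<noteq> 0 \<or> n = 0 \<or> n = 1 \<or> n = -1 \<Longrightarrow> w22_cocycle n m = 0"
  by (auto simp: w22_cocycle_def)

text \<open>A lowest weight vector for the \<open>sl\<^sub>2\<close> spanned by \<open>x\<^bsub>-1\<^esub>, x\<^sub>0, x\<^sub>1\<close>.\<close>

lemma sl2_string:
  assumes "X (-1) y = 0" "y \<in> wt h"
  shows "X (-1) (X 1 y) = scale (2 * h) y"
    and "X (-1) (X 1 (X 1 y)) = scale (4 * h + 2) (X 1 y)"
    and "X (-1) (X 1 (X 1 (X 1 y))) = scale (6 * h + 6) (X 1 (X 1 y))"
proof -
  have c: "w22_cocycle (- 1) 1 = 0" by (simp add: cocycle_0)
  have w: "X 0 (X 1 y) = scale (h + 1) (X 1 y)" "X 0 (X 1 (X 1 y)) = scale (h + 1 + 1) (X 1 (X 1 y))"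
    using X_wt[OF assms(2), of 1] X_wt[OF X_wt[OF assms(2), of 1], of 1] by simp_all
  show 1: "X (-1) (X 1 y) = scale (2 * h) y"
    using assms by (subst XX) (simp add: c)
  show 2: "X (-1) (X 1 (X 1 y)) = scale (4 * h + 2) (X 1 y)"
    by (subst XX) (simp add: 1 w c flip: scale_left_distrib)
  show "X (-1) (X 1 (X 1 (X 1 y))) = scale (6 * h + 6) (X 1 (X 1 y))"
    by (subst XX) (simp add: 2 w c flip: scale_left_distrib)
qed

text \<open>The relation \<open>[x\<^sub>2, y\<^sub>3] = y\<^sub>5\<close> applied to \<open>v\<close>, for \<open>y = x\<close> or \<open>y = I\<close>. Since \<open>x\<^sub>1 v = 0\<close>, the vectors
  \<open>y\<^sub>3 v\<close>, \<open>y\<^sub>4 v\<close>, \<open>y\<^sub>5 v\<close> are multiples of the powers of \<open>x\<^sub>1\<close> applied to \<open>y\<^sub>2 v\<close>, and this gives the first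
  equation. The second one is, up to a factor, its image under \<open>x\<^bsub>-1\<^esub>\<close>.\<close>

lemma tower:
  fixes Y :: "int \<Rightarrow> 'v \<Rightarrow> 'v"
  assumes XY: "\<And>n m v. n + m \<noteq> 0 \<Longrightarrow> X n (Y m v) = Y m (X n v) + scale (of_int (m - n)) (Y (n + m) v)"
    and Y0: "\<And>n. Y n 0 = 0"
    and v: "X 1 v = 0" "X (-1) (X 2 v) = 0" and y: "X (-1) (Y 2 v) = 0" "Y 2 v \<in> wt h"
  shows "scale 6 (X 2 (X 1 (Y 2 v))) = scale 6 (Y 3 (X 2 v)) + X 1 (X 1 (X 1 (Y 2 v)))"
    and "scale (2 * h - 4) (X 2 (Y 2 v)) = scale (h - 2) (X 1 (X 1 (Y 2 v)))"
proof -
  define y where "y = Y 2 v"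
  have 3: "Y 3 v = X 1 y" using XY[of 1 2 v] by (simp add: y_def v Y0)
  have 4: "scale 2 (Y 4 v) = X 1 (X 1 y)" using XY[of 1 3 v] by (simp add: v Y0 3)
  have "scale 6 (Y 5 v) = scale 2 (X 1 (Y 4 v))" using XY[of 1 4 v] by (simp add: v Y0)
  also have "\<dots> = X 1 (X 1 (X 1 y))" using 4 by (metis linear_ops(5))
  finally have 5: "scale 6 (Y 5 v) = X 1 (X 1 (X 1 y))" .
  have "X 2 (X 1 y) = Y 3 (X 2 v) + Y 5 v" using XY[of 2 3 v] by (simp add: 3)
  then show t1: "scale 6 (X 2 (X 1 (Y 2 v))) = scale 6 (Y 3 (X 2 v)) + X 1 (X 1 (X 1 (Y 2 v)))"
    by (simp add: scale_right_distrib 5 flip: y_def)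
  have "Y 2 (X 2 v) = X 2 y" using XY[of 2 2 v] by (simp add: y_def)
  then have A: "X (-1) (Y 3 (X 2 v)) = scale 4 (X 2 y)"
    using XY[of "-1" 3 "X 2 v"] by (simp add: v Y0)
  have string: "X (-1) (X 1 y) = scale (2 * h) y"
      "X (-1) (X 1 (X 1 (X 1 y))) = scale (6 * h + 6) (X 1 (X 1 y))"
    using sl2_string[of y h] y by (simp_all flip: y_def)
  have B: "X (-1) (X 2 (X 1 y)) = scale (2 * h) (X 2 y) + scale 3 (X 1 (X 1 y))"
    by (subst XX) (simp add: string cocycle_0)
  have "X (-1) (scale 6 (X 2 (X 1 y))) = X (-1) (scale 6 (Y 3 (X 2 v)) + X 1 (X 1 (X 1 y)))"
    using t1 unfolding y_def by (rule arg_cong)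
  then have "scale (12 * h) (X 2 y) + scale 18 (X 1 (X 1 y))
      = scale 24 (X 2 y) + scale (6 * h + 6) (X 1 (X 1 y))"
    by (simp only: linear_ops A B string scale_right_distrib scale_scale) (simp add: mult.assoc[symmetric])
  from scale_collect[OF this]
  have "scale (6 * (2 * h - 4)) (X 2 y) = scale (6 * (h - 2)) (X 1 (X 1 y))"
    by (simp add: algebra_simps)
  then show "scale (2 * h - 4) (X 2 (Y 2 v)) = scale (h - 2) (X 1 (X 1 (Y 2 v)))"
    unfolding y_def by (rule scale_cancel_factor) simp
qed

text \<open>Applying \<open>x\<^bsub>-1\<^esub>\<close> once more decides everything: unless \<open>h\<close> is 1 or 2, the vector \<open>y\<close> is killed by
  \<open>x\<^sub>1\<close> and \<open>x\<^sub>2\<close>.\<close>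

lemma tower_half:
  assumes "scale (2 * h - 4) (X 2 y) = scale (h - 2) (X 1 (X 1 y))"
    and "h \<noteq> 2" "X (-1) y = 0" "y \<in> wt h"
  shows "scale 2 (X 2 y) = X 1 (X 1 y)" and "scale (h - 1) (X 1 y) = 0"
proof -
  have "scale ((h - 2) * 2) (X 2 y) = scale ((h - 2) * 1) (X 1 (X 1 y))"
    using assms(1) by (simp add: algebra_simps)
  from scale_cancel_factor[OF this] show 1: "scale 2 (X 2 y) = X 1 (X 1 y)" using assms(2) by simp
  have "X (-1) (X 2 y) = scale 3 (X 1 y)"
    by (subst XX) (simp add: assms cocycle_0)
  then have "scale 6 (X 1 y) = X (-1) (scale 2 (X 2 y))" by simp
  also have "\<dots> = scale (4 * h + 2) (X 1 y)" using sl2_string(2) assms 1 by simp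
  finally have "6 = 4 * h + 2 \<or> X 1 y = 0" by (simp only: scale_cancel_right)
  then show "scale (h - 1) (X 1 y) = 0" by (auto simp: algebra_simps)
qed

text \<open>All equations come from commuting one of \<open>x\<^sub>1\<close>, \<open>I(1)\<close>, \<open>x\<^bsub>-1\<^esub>\<close>, \<open>I(-1)\<close> past other operators until it meets a
  vector that it kills. The parameter is the weight \<open>h\<close> of \<open>x\<^sub>2 v\<close> and \<open>I(2) v\<close>; the weight space that \<open>v\<close>
  avoids has weight \<open>h - 1\<close>.\<close>

lemma generic_relations:
  assumes v: "v \<in> wt (h - 2)" "generic 1 1 v" and "h \<noteq> 2"
  shows "X 2 v \<in> wt h" "J 2 v \<in> wt h" "X (-1) (X 2 v) = 0" "J (-1) (X 2 v) = 0"
    "X (-1) (J 2 v) = 0" "J (-1) (J 2 v) = 0"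
    "J 0 (J 2 v) = 0" "J 1 (J 2 v) = 0" "J 2 (J 2 v) = 0"
    "scale 2 (X 2 (J 2 v)) = X 1 (X 1 (J 2 v))" "scale (h - 1) (X 1 (J 2 v)) = 0"
    "scale 2 (X 2 (X 2 v)) = X 1 (X 1 (X 2 v))" "scale (h - 1) (X 1 (X 2 v)) = 0"
    "J 1 (X 2 v) = X 1 (J 2 v)" "J 2 (X 2 v) = X 2 (J 2 v)"
    "scale 3 (X 2 (X 1 (X 2 v))) = X 1 (X 1 (X 1 (X 2 v)))"
proof -
  have kill: "X 1 v = 0" "J 1 v = 0" using v by simp_all
  show w: "X 2 v \<in> wt h" "J 2 v \<in> wt h"
    using X_wt[OF v(1), of 2] J_wt[OF v(1), of 2] by simp_all
  show low: "X (-1) (X 2 v) = 0" "J (-1) (X 2 v) = 0" "X (-1) (J 2 v) = 0" "J (-1) (J 2 v) = 0"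
    using v by simp_all
  show J1: "J 1 (J 2 v) = 0" using kill by (simp add: JJ[of 1 2])
  have "X (-1) (J 1 (J 2 v)) = J 1 (X (-1) (J 2 v)) + scale 2 (J 0 (J 2 v))"
    by (subst XJ) (simp add: cocycle_0)
  then show "J 0 (J 2 v) = 0" using J1 low by simp
  have XJ0: "X n (J m u) = J m (X n u) + scale (of_int (m - n)) (J (n + m) u)" if "n + m \<noteq> 0" for n m u
    using XJ cocycle_0 that by simp
  have XX0: "X n (X m u) = X m (X n u) + scale (of_int (m - n)) (X (n + m) u)" if "n + m \<noteq> 0" for n m u
    using XX[of n m u] cocycle_0[of n m] that by simp
  have J3: "J 3 v = X 1 (J 2 v)" using XJ0[of 1 2 v] kill by simp
  show "J 1 (X 2 v) = X 1 (J 2 v)" using XJ0[of 2 1 v] kill J3 by simp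
  show "J 2 (X 2 v) = X 2 (J 2 v)" using XJ0[of 2 2 v] by simp
  \<comment> \<open>The vanishing of \<open>I(2) I(2) v\<close>: apply \<open>x\<^bsub>-1\<^esub>\<close> to \<open>x\<^sub>1 I(2) I(2) v = 2 I(3) I(2) v\<close>.\<close>
  have "J 2 (X 1 (J 2 v)) = J 3 (J 2 v)" using JJ[of 2 3 v] J3 by simp
  then have "X 1 (J 2 (J 2 v)) = scale 2 (J 3 (J 2 v))"
    using XJ0[of 1 2 "J 2 v"] scale_left_distrib[of 1 1 "J 3 (J 2 v)"] by simp
  then have "X (-1) (X 1 (J 2 (J 2 v))) = X (-1) (scale 2 (J 3 (J 2 v)))" by simp
  moreover have "X (-1) (J 2 (J 2 v)) = 0" using XJ0[of "-1" 2 "J 2 v"] low J1 by simp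
  then have "X (-1) (X 1 (J 2 (J 2 v))) = scale (2 * (h + 2)) (J 2 (J 2 v))"
    using sl2_string(1)[of "J 2 (J 2 v)" "h + 2"] J_wt[OF w(2), of 2] by simp
  moreover have "X (-1) (J 3 (J 2 v)) = scale 4 (J 2 (J 2 v))"
    using XJ0[of "-1" 3 "J 2 v"] low by simp
  ultimately have "scale (2 * (h + 2)) (J 2 (J 2 v)) = scale 8 (J 2 (J 2 v))" by simp
  then have "2 * (h + 2) = 8 \<or> J 2 (J 2 v) = 0" by simp
  then show "J 2 (J 2 v) = 0" using \<open>h \<noteq> 2\<close> by auto
  have JT: "scale (2 * h - 4) (X 2 (J 2 v)) = scale (h - 2) (X 1 (X 1 (J 2 v)))"
    by (rule tower[OF XJ0 _ kill(1) low(1)]) (use low w in auto)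
  show "scale 2 (X 2 (J 2 v)) = X 1 (X 1 (J 2 v))" "scale (h - 1) (X 1 (J 2 v)) = 0"
    using tower_half[OF JT \<open>h \<noteq> 2\<close>] low w by blast+
  have XT: "scale 6 (X 2 (X 1 (X 2 v))) = scale 6 (X 3 (X 2 v)) + X 1 (X 1 (X 1 (X 2 v)))"
    "scale (2 * h - 4) (X 2 (X 2 v)) = scale (h - 2) (X 1 (X 1 (X 2 v)))"
    by (rule tower[OF XX0 _ kill(1) low(1)]; use low w in auto)+
  show half: "scale 2 (X 2 (X 2 v)) = X 1 (X 1 (X 2 v))" and "scale (h - 1) (X 1 (X 2 v)) = 0"
    using tower_half[OF XT(2) \<open>h \<noteq> 2\<close>] low w by blast+
  have "X 3 (X 2 v) = X 1 (X 2 (X 2 v)) - X 2 (X 1 (X 2 v))"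
    using XX0[of 1 2 "X 2 v"] by simp
  then have "scale 6 (X 3 (X 2 v)) = scale 3 (X 1 (scale 2 (X 2 (X 2 v)))) - scale 6 (X 2 (X 1 (X 2 v)))"
    by (simp add: scale_right_diff_distrib)
  also have "\<dots> = scale 3 (X 1 (X 1 (X 1 (X 2 v)))) - scale 6 (X 2 (X 1 (X 2 v)))"
    by (simp only: half)
  finally have "scale 6 (X 2 (X 1 (X 2 v))) = scale 3 (X 1 (X 1 (X 1 (X 2 v))))
      - scale 6 (X 2 (X 1 (X 2 v))) + X 1 (X 1 (X 1 (X 2 v)))"
    using XT(1) by simp
  then have "scale 6 (X 2 (X 1 (X 2 v))) + scale 6 (X 2 (X 1 (X 2 v)))
      = scale 3 (X 1 (X 1 (X 1 (X 2 v)))) + scale 1 (X 1 (X 1 (X 1 (X 2 v))))"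
    by (simp add: algebra_simps)
  then have "scale (4 * 3) (X 2 (X 1 (X 2 v))) = scale (4 * 1) (X 1 (X 1 (X 1 (X 2 v))))"
    by (simp only: scale_left_distrib[symmetric]) simp
  from scale_cancel_factor[OF this]
  show "scale 3 (X 2 (X 1 (X 2 v))) = X 1 (X 1 (X 1 (X 2 v)))" by simp
qed

text \<open>Outside \<open>h = 1, 2\<close> the relations turn \<open>I(2) v\<close>, then \<open>x\<^sub>2 v\<close>, and finally \<open>v\<close> into highest weight vectors.\<close>

lemma generic_vector_zero:
  assumes v: "v \<in> wt (h - 2)" "generic 1 1 v" and h: "h \<noteq> 1" "h \<noteq> 2"
  shows "v = 0"
proof -
  note R = generic_relations[OF v h(2)]
  have "J 2 v = 0"
    by (rule no_highest_weight_vector[OF R(2)]) (use R h in auto)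
  moreover have "X 2 v = 0"
    by (rule no_highest_weight_vector[OF R(1)]) (use R h \<open>J 2 v = 0\<close> in auto)
  ultimately show "v = 0"
    using no_highest_weight_vector[OF v(1)] v(2) by simp
qed

text \<open>The symmetry replaces \<open>h\<close> by \<open>2 - h\<close> when it passes from \<open>v\<close> to \<open>x\<^sub>2 v\<close> or \<open>I(2) v\<close>. So \<open>h = 2\<close> becomes the
  harmless value 0, and only the fixed point \<open>h = 1\<close> survives.\<close>

lemma generic_weight:
  assumes v: "v \<in> wt (h - 2)" "generic 2 1 v" "v \<noteq> 0"
  shows "h = 1"
proof (rule ccontr)
  assume "h \<noteq> 1"
  moreover have "h \<noteq> 2"
  proof
    assume "h = 2"
    interpret m: w22_rep scale "\<lambda>n v. - X (- n) v" "\<lambda>n v. - J (- n) v" "- c" "- c1"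
      by (rule mirror)
    have *: "u = 0" if "u \<in> wt 2" "generic 1 (-1) u" for u
      using m.generic_vector_zero[of u 0] that by (simp add: generic_mirror)
    have "X 2 v \<in> wt 2" "J 2 v \<in> wt 2"
      using X_wt[OF v(1), of 2] J_wt[OF v(1), of 2] \<open>h = 2\<close> by simp_all
    then have "X 2 v = 0" "J 2 v = 0"
      using *[of "X 2 v"] *[of "J 2 v"] v(2) by (simp_all add: numeral_2_eq_2)
    then show False
      using no_highest_weight_vector[OF v(1)] v(2,3) by (simp add: numeral_2_eq_2)
  qed
  ultimately show False
    using generic_vector_zero[OF v(1)] generic_less[of 1 1 v] v(2,3) by (simp add: numeral_2_eq_2)
qed

section \<open>The ideal spanned by the \<open>I(n)\<close> acts by zero\<close>

lemma J_positive_kills: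
  assumes "X 1 v = 0" "J 1 v = 0" "J 2 v = 0" and "n \<ge> 1"
  shows "J n v = 0"
  using \<open>n \<ge> 1\<close>
proof (induction n rule: int_ge_induct)
  case (step n)
  show ?case
  proof (cases "n = 1")
    case False
    then have "(of_int (n - 1) :: complex) \<noteq> 0"
      using step.hyps by auto
    then show ?thesis
      using XJ[of 1 n v] step.IH assms(1) by (simp add: add.commute cocycle_0)
  qed (use assms in simp)
qed (use assms in simp)

text \<open>Once \<open>c1 = 0\<close>, the vectors killed by every \<open>I(n)\<close> form a submodule, so it suffices that \<open>z\<close> is one of
  them. The central charge is read off from \<open>[x\<^sub>2, I(-2)] z\<close>. For \<open>n \<ge> 3\<close> the vector \<open>I(n) z\<close> is a lowest weight vector by induction,
  hence zero; negative \<open>n\<close> follow from \<open>I(-1) z = I(-2) z = 0\<close> by commuting with \<open>x\<^bsub>-1\<^esub>\<close>.\<close>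

lemma J_vanishes:
  assumes z: "z \<in> wt 1" "z \<noteq> 0" "generic 1 (-1) z"
    and Jz: "J (-2) z = 0" "J 0 z = 0" "J 1 z = 0" "J 2 z = 0"
    and half: "scale 2 (X 2 z) = X 1 (X 1 z)"
  shows "J n m = 0"
proof -
  define u where "u = X (-2) z"
  have low: "X (-1) z = 0" "J (-1) z = 0" and u: "X 1 u = 0" "J 1 u = 0"
    using z(3) by (simp_all add: u_def)
  have c1: "c1 = 0"
  proof -
    have a: "J (-2) (X 1 z) = 0" using JX[of "-2" 1 z] Jz low by (simp add: cocycle_0)
    have "J (-1) (X 1 z) = 0" using JX[of "-1" 1 z] Jz low by (simp add: cocycle_0)
    then have "J (-2) (X 1 (X 1 z)) = 0"
      using JX[of "-2" 1 "X 1 z"] a by (simp add: cocycle_0)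
    then have "scale 2 (J (-2) (X 2 z)) = 0" by (simp flip: half)
    then have "scale (w22_cocycle (-2) 2 * c1) z = 0"
      using JX[of "-2" 2 z] Jz by simp
    then show ?thesis using z(2) by (simp add: w22_cocycle_def)
  qed
  have "J 2 u = 0" using JX[of 2 "-2" z] Jz c1 by (simp add: u_def)
  then have Ju: "J n u = 0" if "n \<ge> 1" for n using J_positive_kills[of u n] u that by blast
  have pos: "J (int n) z = 0" for n
  proof (induction n rule: less_induct)
    case (less n)
    show ?case
    proof (cases "n \<le> 2")
      case True
      then have "n = 0 \<or> n = 1 \<or> n = 2" by auto
      then show ?thesis using Jz by auto
    next
      case False
      then have IH: "J (int n - 1) z = 0" "J (int n - 2) z = 0"
        using less.IH[of "n - 1"] less.IH[of "n - 2"] by (simp_all add: of_nat_diff)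
      show ?thesis
      proof (rule no_lowest_weight_vector)
        show "J (int n) z \<in> wt (1 + of_int (int n))" by (rule J_wt[OF z(1)])
        show "X (-1) (J (int n) z) = 0"
          using XJ[of "-1" "int n" z] IH low by (simp add: cocycle_0)
        show "X (-2) (J (int n) z) = 0"
          using XJ[of "-2" "int n" z] IH Ju[of "int n"] c1 False by (simp flip: u_def)
        show "J (-1) (J (int n) z) = 0" "J (-2) (J (int n) z) = 0"
          using low Jz by (simp_all add: JJ[of _ "int n"])
      qed
    qed
  qed
  interpret m: w22_rep scale "\<lambda>n v. - X (- n) v" "\<lambda>n v. - J (- n) v" "- c" "- c1"
    by (rule mirror)
  have neg: "J (- n) z = 0" if "n \<ge> 1" for n
    using m.J_positive_kills[of z n] low Jz that by simp
  have "J n z = 0" for n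
    using pos[of "nat n"] neg[of "- n"] by (cases "n \<ge> 0") auto
  moreover have "{m. \<forall>n. J n m = 0} = {0} \<or> {m. \<forall>n. J n m = 0} = UNIV"
    by (rule irred) (auto simp: subspace_def JX c1 JJ)
  ultimately show ?thesis using z(2) by blast
qed

text \<open>The relations and genericity give all hypotheses on \<open>z = I(2) v\<close> except \<open>I(-2) z = 0\<close>. If that one fails,
  \<open>I(-2) I(2) v\<close> satisfies the mirrored hypotheses, because \<open>I(2) I(2) v = 0\<close>.\<close>

lemma J_vanishes_if_J2:
  assumes v: "v \<in> wt (-1)" "generic 3 1 v" and "J 2 v \<noteq> 0"
  shows "J n m = 0"
proof -
  have g: "generic 1 1 v" "generic 2 (-1) (J 2 v)" "generic 1 (-1) (J 2 v)"
    using v(2) by (simp_all add: eval_nat_numeral)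
  have "v \<in> wt (1 - 2)" using v by simp
  note R = generic_relations[OF this g(1)]
  show ?thesis
  proof (cases "J (-2) (J 2 v) = 0")
    case True
    show ?thesis
      by (rule J_vanishes[of "J 2 v"]) (use R g True assms in auto)
  next
    case False
    interpret m: w22_rep scale "\<lambda>n v. - X (- n) v" "\<lambda>n v. - J (- n) v" "- c" "- c1"
      by (rule mirror)
    have "J 2 v \<in> m.wt (1 - 2)" using R(2) by simp
    moreover have "m.generic 1 1 (J 2 v)" using g by (simp add: generic_mirror)
    ultimately have mR: "- J (- 2) (J 2 v) \<in> m.wt 1"
      "- J (- 0) (- J (- 2) (J 2 v)) = 0"
      "- J (- 1) (- J (- 2) (J 2 v)) = 0" "- J (- 2) (- J (- 2) (J 2 v)) = 0"
      "scale 2 (- X (- 2) (- J (- 2) (J 2 v))) = - X (- 1) (- X (- 1) (- J (- 2) (J 2 v)))"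
      using m.generic_relations[of "J 2 v" 1] by auto
    have "- J (- (- n)) m = 0"
    proof (rule m.J_vanishes[OF mR(1) _ _ _ mR(2-5)])
      show "- J (- 2) (J 2 v) \<noteq> 0" using False by simp
      show "m.generic 1 (- 1) (- J (- 2) (J 2 v))"
        using g(2) unfolding generic_mirror by (simp add: eval_nat_numeral)
      show "- J (- (- 2)) (- J (- 2) (J 2 v)) = 0"
        using R by (simp add: JJ[of 2 "-2"])
    qed
    then show ?thesis by simp
  qed
qed

text \<open>If \<open>I(2) v = 0\<close>, then \<open>z = x\<^sub>2 v\<close> serves, or else \<open>x\<^sub>2 v\<close> is a mirrored generic vector that \<open>I(-2)\<close> does
  not kill.\<close>

lemma J_vanishes_if_generic:
  assumes v: "v \<in> wt (-1)" "generic 4 1 v" "v \<noteq> 0"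
  shows "J n m = 0"
proof (cases "J 2 v = 0")
  case False
  have "generic 3 1 v" using generic_less[of 3 1 v] v(2) by (simp add: eval_nat_numeral)
  from J_vanishes_if_J2[OF v(1) this False] show ?thesis .
next
  case True
  define w where "w = X 2 v"
  have g: "generic 1 1 v" "generic 3 (-1) w" "generic 1 (-1) w"
    using v(2) by (simp_all add: eval_nat_numeral w_def)
  have "v \<in> wt (1 - 2)" using v by simp
  note R = generic_relations[OF this g(1), folded w_def]
  have "w \<noteq> 0"
    using no_highest_weight_vector[OF v(1)] v(3) g(1) True w_def by auto
  have J1: "J 1 w = 0" "J 2 w = 0" using R True by simp_all
  have J0: "J 0 w = 0" using XJ[of "-1" 1 w] R(3) J1 by (simp add: cocycle_0)
  show ?thesis
  proof (cases "J (-2) w = 0")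
    case True
    show ?thesis
      by (rule J_vanishes[of w]) (use R g True J0 J1 \<open>w \<noteq> 0\<close> in auto)
  next
    case False
    interpret m: w22_rep scale "\<lambda>n v. - X (- n) v" "\<lambda>n v. - J (- n) v" "- c" "- c1"
      by (rule mirror)
    have "- J (- (- n)) m = 0"
      by (rule m.J_vanishes_if_J2[of w]) (use R(1) g False in \<open>simp_all add: generic_mirror\<close>)
    then show ?thesis by simp
  qed
qed


section \<open>The remaining case is an intermediate series module\<close>

text \<open>In the intermediate series module with basis \<open>v\<^sub>k\<close>, \<open>k \<noteq> 0\<close>, and \<open>x\<^sub>j v\<^sub>k = k v\<^bsub>j+k\<^esub>\<close>, the vector \<open>w = v\<^sub>1\<close>
  has \<open>x\<^sub>1\<^sup>k w = k! v\<^bsub>k+1\<^esub>\<close>; this is where the coefficients come from. That \<open>x\<^sub>2\<close> acts as expected is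
  proved by showing that the difference of both sides is killed by \<open>x\<^bsub>-1\<^esub>\<close> and \<open>x\<^bsub>-2\<^esub>\<close>, so it is a lowest
  weight vector. The same computation for \<open>k = 1\<close>, where the equation is a hypothesis, forces
  \<open>c = 0\<close>.\<close>

lemma X_string:
  assumes J0: "\<And>n v. J n v = 0" and w: "w \<in> wt 1" "w \<noteq> 0" "X (-1) w = 0" "X 1 (X (-2) w) = 0"
    and half: "scale 2 (X 2 w) = X 1 (X 1 w)"
    and third: "scale 3 (X 2 (X 1 w)) = X 1 (X 1 (X 1 w))"
  shows "(X 1 ^^ k) w \<in> wt (1 + of_nat k)"
    and "X (-1) ((X 1 ^^ k) w) = scale (of_nat (k * (k + 1))) ((X 1 ^^ (k - 1)) w)"
    and "X (-2) ((X 1 ^^ Suc k) w) = scale (of_nat ((k + 2) * (k + 1) * k)) ((X 1 ^^ (k - 1)) w)"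
    and "c = 0"
    and "scale (of_nat (k + 2)) (X 2 ((X 1 ^^ k) w)) = (X 1 ^^ (k + 2)) w"
proof -
  define W where "W k = (X 1 ^^ k) w" for k
  have W0: "W 0 = w" and WS: "X 1 (W k) = W (Suc k)" for k by (simp_all add: W_def)
  have W1: "X 1 w = W 1" using WS[of 0] W0 by simp
  have wt: "W k \<in> wt (1 + of_nat k)" for k
  proof (induction k)
    case (Suc k)
    then show ?case using X_wt[OF Suc, of 1] by (simp add: WS algebra_simps)
  qed (use w W0 in simp)
  then have X0: "X 0 (W k) = scale (1 + of_nat k) (W k)" for k by simp
  have m1: "X (-1) (W k) = scale (of_nat (k * (k + 1))) (W (k - 1))" for k
  proof (induction k)
    case (Suc k)
    have "X (-1) (W (Suc k)) = X 1 (X (-1) (W k)) + scale 2 (X 0 (W k))"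
      by (subst WS[symmetric], subst XX) (simp add: cocycle_0)
    also have "X 1 (X (-1) (W k)) = scale (of_nat (k * (k + 1))) (W k)"
      using Suc by (cases k) (simp_all add: WS)
    finally show ?case by (simp add: X0 algebra_simps flip: scale_left_distrib)
  qed (use w W0 in simp)
  have m2: "X (-2) (W (Suc k)) = scale (of_nat ((k + 2) * (k + 1) * k)) (W (k - 1))" for k
  proof (induction k)
    case 0
    have "X (-2) (X 1 w) = 0" by (subst XX) (use w in \<open>simp add: cocycle_0\<close>)
    then show ?case using WS[of 0] W0 by simp
  next
    case (Suc k)
    have "X (-2) (W (Suc (Suc k))) = X 1 (X (-2) (W (Suc k))) + scale 3 (X (-1) (W (Suc k)))"
      by (subst WS[symmetric], subst XX) (simp add: cocycle_0)
    also have "X 1 (X (-2) (W (Suc k))) = scale (of_nat ((k + 2) * (k + 1) * k)) (W k)"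
      using Suc by (cases k) (simp_all add: WS)
    finally show ?case by (simp add: m1 flip: scale_left_distrib) (simp add: algebra_simps)
  qed
  have "W 1 \<noteq> 0"
  proof
    assume "W 1 = 0"
    then have "X 1 w = 0" "X 2 w = 0" using half W1 by auto
    then show False using no_highest_weight_vector[OF w(1)] J0 w(2) by simp
  qed
  have W3: "X 1 (X 1 (X 1 w)) = W 3" by (simp add: W_def eval_nat_numeral)
  have "X (-2) (X 2 (W 1)) = scale 8 (W 1) + scale (w22_cocycle (-2) 2 * c) (W 1)"
    using m2[of 0] X0[of 1] by (subst XX) simp
  then have A: "X (-2) (scale 3 (X 2 (W 1))) = scale 24 (W 1) + scale (3 * (w22_cocycle (-2) 2 * c)) (W 1)"
    by (simp add: scale_right_distrib)
  have B: "X (-2) (W 3) = scale 24 (W 1)"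
    using m2[of 2] by (simp add: eval_nat_numeral)
  have "scale 3 (X 2 (W 1)) = W 3" using third W1 W3 by simp
  then have "scale (3 * (w22_cocycle (-2) 2 * c)) (W 1) = 0"
    using A B by (simp only: add_cancel_right_right)
  then show c: "c = 0" using \<open>W 1 \<noteq> 0\<close> by (simp add: w22_cocycle_def)
  have p2: "scale (of_nat (k + 2)) (X 2 (W k)) = W (k + 2)" for k
  proof (induction k rule: less_induct)
    case (less k)
    consider "k = 0" | "k = 1" | "k \<ge> 2" by linarith
    then show ?case
    proof cases
      case 1
      then show ?thesis using half by (simp add: W_def eval_nat_numeral)
    next
      case 2
      then show ?thesis using third by (simp add: W_def eval_nat_numeral)
    next
      case 3
      then obtain j where k: "k = j + 2" using le_Suc_ex by (metis add.commute)
      define y where "y = scale (of_nat (k + 2)) (X 2 (W k)) - W (k + 2)"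
      have IH: "scale (of_nat (j + 3)) (X 2 (W (j + 1))) = W (j + 3)"
        "scale (of_nat (j + 2)) (X 2 (W j)) = W (j + 2)"
        using less.IH[of "j + 1"] less.IH[of j] k by (simp_all add: eval_nat_numeral)
      have e1: "(of_nat (k * (k + 1)) :: complex) = of_nat (j + 2) * of_nat (j + 3)"
        and e2: "(of_nat ((j + 3) * (j + 2) * (j + 1)) :: complex)
          = of_nat ((j + 3) * (j + 1)) * of_nat (j + 2)"
        by (simp_all add: k algebra_simps)
      have "y = 0"
      proof (rule no_lowest_weight_vector)
        have "X 2 (W k) \<in> wt (1 + of_nat (k + 2))"
          using X_wt[OF wt, of 2 k] by (simp add: algebra_simps)
        then show "y \<in> wt (1 + of_nat (k + 2))"
          unfolding y_def using wt[of "k + 2"]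
          by (intro subspace_diff[OF subspace_wt] subspace_scale[OF subspace_wt])
        have "X (-1) (X 2 (W k)) = X 2 (X (-1) (W k)) + scale 3 (W (j + 3))"
          by (subst XX) (simp add: cocycle_0 WS k eval_nat_numeral)
        also have "X 2 (X (-1) (W k)) = scale (of_nat (j + 2)) (scale (of_nat (j + 3)) (X 2 (W (j + 1))))"
          unfolding m1 e1 by (simp only: linear_ops scale_scale) (simp add: k)
        also have "\<dots> = scale (of_nat (j + 2)) (W (j + 3))" by (simp only: IH)
        finally have "X (-1) (X 2 (W k)) = scale (of_nat (j + 5)) (W (j + 3))"
          by (simp flip: scale_left_distrib)
        moreover have "X (-1) (W (k + 2)) = scale (of_nat ((j + 4) * (j + 5))) (W (j + 3))"
          by (simp add: m1 k eval_nat_numeral)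
        ultimately show "X (-1) y = 0" by (simp add: y_def k)
        have "X (-2) (X 2 (W k)) = X 2 (X (-2) (W k)) + scale (4 * of_nat (j + 3)) (W (j + 2))"
          using X0[of k] by (subst XX) (simp add: c k)
        also have "X (-2) (W k) = scale (of_nat ((j + 3) * (j + 2) * (j + 1))) (W j)"
          using m2[of "j + 1"] k by (simp add: eval_nat_numeral)
        also have "X 2 \<dots> = scale (of_nat ((j + 3) * (j + 1))) (scale (of_nat (j + 2)) (X 2 (W j)))"
          unfolding e2 by (simp only: linear_ops scale_scale)
        also have "\<dots> = scale (of_nat ((j + 3) * (j + 1))) (W (j + 2))" by (simp only: IH)
        finally have "X (-2) (X 2 (W k)) = scale (of_nat ((j + 3) * (j + 5))) (W (j + 2))"
          by (simp flip: scale_left_distrib) (simp add: algebra_simps)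
        moreover have "X (-2) (W (k + 2)) = scale (of_nat ((j + 5) * (j + 4) * (j + 3))) (W (j + 2))"
          using m2[of "j + 3"] by (simp add: k eval_nat_numeral)
        ultimately show "X (-2) y = 0" by (simp add: y_def k mult_ac)
      qed (simp_all add: J0)
      then show ?thesis by (simp add: y_def)
    qed
  qed
  show "(X 1 ^^ k) w \<in> wt (1 + of_nat k)"
    "X (-1) ((X 1 ^^ k) w) = scale (of_nat (k * (k + 1))) ((X 1 ^^ (k - 1)) w)"
    "X (-2) ((X 1 ^^ Suc k) w) = scale (of_nat ((k + 2) * (k + 1) * k)) ((X 1 ^^ (k - 1)) w)"
    "scale (of_nat (k + 2)) (X 2 ((X 1 ^^ k) w)) = (X 1 ^^ (k + 2)) w"
    using wt[of k] m1[of k] m2[of k] p2[of k] unfolding W_def by blast+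
qed

lemma X_nonneg_closed:
  assumes T: "subspace T" and closed: "\<And>s. s \<in> T \<Longrightarrow> X 1 s \<in> T" "\<And>s. s \<in> T \<Longrightarrow> X 2 s \<in> T"
    and "n \<ge> 1" "s \<in> T"
  shows "X n s \<in> T"
  using \<open>n \<ge> 1\<close> \<open>s \<in> T\<close>
proof (induction n arbitrary: s rule: int_ge_induct)
  case (step n)
  show ?case
  proof (cases "n = 1")
    case False
    let ?a = "of_int (n - 1) :: complex"
    have "scale ?a (X (1 + n) s) = X 1 (X n s) - X n (X 1 s)"
      using XX[of 1 n s] by (simp add: cocycle_0)
    also have "\<dots> \<in> T" using T closed(1) step.IH step.prems by (intro subspace_diff) auto
    finally have "scale (1 / ?a) (scale ?a (X (1 + n) s)) \<in> T" by (rule subspace_scale[OF T])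
    moreover have "?a \<noteq> 0" using False step.hyps by (auto simp: of_int_eq_1_iff)
    ultimately show ?thesis by (simp add: add.commute)
  qed (use closed step.prems in simp)
qed (use closed in auto)

lemma X_closed:
  assumes T: "subspace T" and closed: "\<And>s. s \<in> T \<Longrightarrow> X 1 s \<in> T" "\<And>s. s \<in> T \<Longrightarrow> X 2 s \<in> T"
    "\<And>s. s \<in> T \<Longrightarrow> X (-1) s \<in> T" "\<And>s. s \<in> T \<Longrightarrow> X (-2) s \<in> T" and s: "s \<in> T"
  shows "X n s \<in> T"
proof -
  interpret m: w22_rep scale "\<lambda>n v. - X (- n) v" "\<lambda>n v. - J (- n) v" "- c" "- c1"
    by (rule mirror)
  consider "n \<ge> 1" | "n = 0" | "- n \<ge> 1" by linarith
  then show ?thesis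
  proof cases
    case 1
    then show ?thesis using X_nonneg_closed[OF T closed(1,2) _ s] by blast
  next
    case 2
    have "scale 2 (X 0 s) = X (-1) (X 1 s) - X 1 (X (-1) s)"
      using XX[of "-1" 1 s] by (simp add: cocycle_0)
    also have "\<dots> \<in> T" using T closed s by (intro subspace_diff) auto
    finally have "scale (1 / 2) (scale 2 (X 0 s)) \<in> T" by (rule subspace_scale[OF T])
    then show ?thesis using 2 by simp
  next
    case 3
    have "- X (- (- n)) s \<in> T"
      by (rule m.X_nonneg_closed[OF T _ _ 3 s]) (use closed subspace_neg[OF T] in auto)
    then show ?thesis using subspace_neg[OF T] by fastforce
  qed
qed

text \<open>The strings \<open>x\<^sub>1\<^sup>k w\<close> and \<open>x\<^bsub>-1\<^esub>\<^sup>k u\<close> starting at \<open>w = x\<^sub>2 v\<close> and \<open>u = - x\<^bsub>-2\<^esub> w\<close> span a submodule, hence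
  everything. Apart from \<open>u\<close>, no nonzero vector of this spanning set has weight \<open>-1\<close>.\<close>

lemma generic_weight_space_finite:
  assumes v: "v \<in> wt (-1)" "generic 4 1 v" "v \<noteq> 0"
  shows "\<not> infinite_dim (wt (-1))"
proof -
  interpret m: w22_rep scale "\<lambda>n v. - X (- n) v" "\<lambda>n v. - J (- n) v" "- c" "- c1"
    by (rule mirror)
  have J0: "J n m = 0" for n m using J_vanishes_if_generic[OF v] .
  define w where "w = X 2 v"
  define u where "u = - X (- 2) w"
  have g: "generic 1 1 v" "generic 1 (-1) w" "generic 1 1 (X (-2) w)"
    using v(2) by (simp_all add: eval_nat_numeral w_def)
  have "v \<in> wt (1 - 2)" using v by simp
  note R = generic_relations[OF this g(1), folded w_def]
  have w: "w \<in> wt 1" "w \<noteq> 0"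
    using R(1) no_highest_weight_vector[OF v(1)] v(3) g(1) J0 w_def by auto
  have "w \<in> m.wt (1 - 2)" "m.generic 1 1 w" using w g by (simp_all add: generic_mirror)
  note mR = m.generic_relations[OF this]
  have u: "u \<noteq> 0"
    using no_lowest_weight_vector[OF w(1)] w(2) R(3) J0 u_def by auto
  have S: "(X 1 ^^ k) w \<in> wt (1 + of_nat k)"
    "X (-1) ((X 1 ^^ k) w) = scale (of_nat (k * (k + 1))) ((X 1 ^^ (k - 1)) w)"
    "X (-2) ((X 1 ^^ Suc k) w) = scale (of_nat ((k + 2) * (k + 1) * k)) ((X 1 ^^ (k - 1)) w)"
    "c = 0"
    "scale (of_nat (k + 2)) (X 2 ((X 1 ^^ k) w)) = (X 1 ^^ (k + 2)) w" for k
    by (rule X_string[OF J0 w]; use R g in simp)+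
  let ?X = "\<lambda>v. - X (- 1) v"
  have mu: "u \<in> m.wt 1" "- X (- (- 1)) u = 0" "- X (- 1) (- X (- (- 2)) u) = 0"
    "scale 2 (- X (- 2) u) = - X (- 1) (- X (- 1) u)"
    "scale 3 (- X (- 2) (- X (- 1) u)) = - X (- 1) (- X (- 1) (- X (- 1) u))"
    using mR g(3) by (simp_all add: u_def)
  have mS: "(?X ^^ k) u \<in> m.wt (1 + of_nat k)"
    "- X (- (- 1)) ((?X ^^ k) u) = scale (of_nat (k * (k + 1))) ((?X ^^ (k - 1)) u)"
    "- X (- (- 2)) ((?X ^^ Suc k) u) = scale (of_nat ((k + 2) * (k + 1) * k)) ((?X ^^ (k - 1)) u)"
    "scale (of_nat (k + 2)) (- X (- 2) ((?X ^^ k) u)) = (?X ^^ (k + 2)) u" for k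
    by (rule m.X_string[OF _ mu(1) u mu(2-5)]; simp add: J0)+
  have "X 2 u = w"
  proof -
    have "X (-2) (scale 2 (X 2 w)) = scale 6 w"
      using S(3)[of 1] S(5)[of 0] by (simp add: eval_nat_numeral)
    then have "scale 2 (X (-2) (X 2 w)) = scale 2 (scale 3 w)" by simp
    then have "X (-2) (X 2 w) = scale 3 w" by (simp only: scale_cancel_left) simp
    moreover have "X (-2) (X 2 w) = X 2 (X (-2) w) + scale 4 w"
      using w S(4) by (subst XX) simp
    ultimately have "X 2 u = scale 4 w - scale 3 w" by (simp add: u_def algebra_simps)
    then show ?thesis by (simp flip: scale_left_diff_distrib)
  qed
  define B where "B = range (\<lambda>k. (X 1 ^^ k) w) \<union> range (\<lambda>k. (?X ^^ k) u)"
  have BW: "(X 1 ^^ k) w \<in> span B" and BU: "(?X ^^ k) u \<in> span B" for k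
    unfolding B_def by (auto intro!: span_base)
  have div: "x \<in> span B" if "scale (of_nat (k + 2)) x \<in> span B" for k x
  proof -
    have "scale (1 / of_nat (k + 2)) (scale (of_nat (k + 2)) x) \<in> span B"
      using that by (rule span_scale)
    moreover have "(of_nat (k + 2) :: complex) \<noteq> 0" by (simp only: of_nat_eq_0_iff)
    ultimately show ?thesis by simp
  qed
  have W: "X 1 ((X 1 ^^ k) w) \<in> span B" "X (-1) ((X 1 ^^ k) w) \<in> span B"
    "X 2 ((X 1 ^^ k) w) \<in> span B" "X (-2) ((X 1 ^^ k) w) \<in> span B" for k
  proof -
    show "X 1 ((X 1 ^^ k) w) \<in> span B" using BW[of "Suc k"] by simp
    show "X (-1) ((X 1 ^^ k) w) \<in> span B" unfolding S(2) by (intro span_scale BW)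
    show "X 2 ((X 1 ^^ k) w) \<in> span B" by (rule div[of k]) (unfold S(5), rule BW)
    show "X (-2) ((X 1 ^^ k) w) \<in> span B"
    proof (cases k)
      case 0
      then show ?thesis using span_neg[OF BU[of 0]] by (simp add: u_def)
    qed (use S(3) in \<open>auto intro: span_scale BW simp del: funpow.simps\<close>)
  qed
  have U: "- X (- 1) ((?X ^^ k) u) \<in> span B" "- X (- (- 1)) ((?X ^^ k) u) \<in> span B"
    "- X (- 2) ((?X ^^ k) u) \<in> span B" "- X (- (- 2)) ((?X ^^ k) u) \<in> span B" for k
  proof -
    show "- X (- 1) ((?X ^^ k) u) \<in> span B" using BU[of "Suc k"] by simp
    show "- X (- (- 1)) ((?X ^^ k) u) \<in> span B" unfolding mS(2) by (intro span_scale BU)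
    show "- X (- 2) ((?X ^^ k) u) \<in> span B" by (rule div[of k]) (unfold mS(4), rule BU)
    show "- X (- (- 2)) ((?X ^^ k) u) \<in> span B"
    proof (cases k)
      case 0
      then show ?thesis using span_neg[OF BW[of 0]] \<open>X 2 u = w\<close> by simp
    next
      case (Suc j)
      show ?thesis unfolding Suc mS(3) by (intro span_scale BU)
    qed
  qed
  have step: "X i s \<in> span B" if "i \<in> {1, 2, -1, -2}" "s \<in> span B" for i s
  proof (rule span_invariant[OF X_linear _ that(2)])
    show "X i ` B \<subseteq> span B"
      using that(1) W U[THEN span_neg] unfolding B_def by auto
  qed
  have "span B = UNIV"
  proof (rule span_submodule)
    show "X n s \<in> span B" if "s \<in> B" for n s
      by (rule X_closed) (use step that in \<open>auto intro: span_base\<close>)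
    show "J n s \<in> span B" for n s by (simp add: J0 span_zero)
    show "(X 1 ^^ 0) w \<in> B" unfolding B_def by blast
    show "(X 1 ^^ 0) w \<noteq> 0" using w by simp
  qed
  moreover have "\<exists>\<nu>. s \<in> wt \<nu>" if s: "s \<in> B" for s
  proof -
    consider k where "s = (X 1 ^^ k) w" | k where "s = (?X ^^ k) u" using s B_def by blast
    then show ?thesis
    proof cases
      case (1 k)
      then show ?thesis using S(1)[of k] by blast
    next
      case (2 k)
      then have "s \<in> m.wt (1 + of_nat k)" using mS(1) by blast
      then have "s \<in> wt (- (1 + of_nat k))" by (simp only: mem_Collect_eq minus_zero scale_minus_left) (metis minus_minus)
      then show ?thesis by blast
    qed
  qed
  ultimately have "wt (-1) \<subseteq> span (B \<inter> wt (-1))" by (rule wt_subset_span)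
  also have "span (B \<inter> wt (-1)) \<subseteq> span {u}"
  proof (rule span_minimal)
    show "B \<inter> wt (-1) \<subseteq> span {u}"
    proof
      fix s assume s: "s \<in> B \<inter> wt (-1)"
      then consider k where "s = (X 1 ^^ k) w" | k where "s = (?X ^^ k) u" using B_def by blast
      then show "s \<in> span {u}"
      proof cases
        case (1 k)
        then have "scale (1 + of_nat k) s = scale (-1) s" using S(1)[of k] s by simp
        then have "1 + of_nat k = (-1 :: complex) \<or> s = 0" by (simp only: scale_cancel_right)
        moreover have "Re (1 + of_nat k) \<noteq> Re (-1)" by simp
        ultimately show ?thesis using span_zero by metis
      next
        case (2 k)
        then have "scale (1 + of_nat k) s = scale 1 s" using mS(1)[of k] s by simp
        then have "1 + of_nat k = (1 :: complex) \<or> s = 0" by (simp only: scale_cancel_right)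
        then show ?thesis using span_zero 2 by (auto intro: span_base)
      qed
    qed
  qed simp
  finally show ?thesis using infinite_dim_iff[OF subspace_wt] by blast
qed


section \<open>The support and the weight spaces\<close>

lemma wt_zero_outside_coset:
  assumes v: "v \<in> wt \<mu>" "v \<noteq> 0" and \<nu>: "\<nu> \<notin> {\<mu> + of_int k |k. True}"
  shows "wt \<nu> = {0}"
proof -
  let ?S = "\<Union>k. wt (\<mu> + of_int k)"
  have "span ?S = UNIV"
  proof (rule span_submodule)
    fix n s assume "s \<in> ?S"
    then obtain k where "s \<in> wt (\<mu> + of_int k)" by blast
    then have "X n s \<in> wt (\<mu> + of_int (k + n))" "J n s \<in> wt (\<mu> + of_int (k + n))"
      using X_wt[of s "\<mu> + of_int k" n] J_wt[of s "\<mu> + of_int k" n] by (simp_all add: add.assoc)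
    then show "X n s \<in> span ?S" "J n s \<in> span ?S" by (blast intro: span_base)+
  next
    show "v \<in> ?S" using v by (auto intro!: exI[of _ 0])
  qed fact
  then have "wt \<nu> \<subseteq> span (?S \<inter> wt \<nu>)" by (rule wt_subset_span) blast
  also have "span (?S \<inter> wt \<nu>) \<subseteq> {0}"
  proof (rule span_minimal[OF subsetI subspace_single_0])
    fix s assume "s \<in> ?S \<inter> wt \<nu>"
    then obtain k where "scale (\<mu> + of_int k) s = scale \<nu> s" by auto
    then show "s \<in> {0}" using \<nu> by (auto simp only: scale_cancel_right)
  qed
  finally show ?thesis by auto
qed

text \<open>Otherwise a generic vector exists below the finite-dimensional weight space. Its weight must be
  \<open>-1\<close>, and that weight space is then finite-dimensional after all.\<close>

lemma infinite_dim_next: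
  assumes "infinite_dim (wt \<mu>)"
  shows "infinite_dim (wt (\<mu> + 1))"
proof (rule ccontr)
  assume "\<not> ?thesis"
  then obtain v where v: "v \<in> wt \<mu>" "v \<noteq> 0" "generic 4 1 v"
    using generic_exists[of "\<mu> + 1" 4] assms by auto
  then have g2: "generic 2 1 v"
    using generic_less[of 3 1 v] generic_less[of 2 1 v] by (simp add: eval_nat_numeral)
  have "\<mu> + 2 = 1" using generic_weight[of v "\<mu> + 2"] v g2 by simp
  then have "\<mu> = - 1" by (simp add: eq_neg_iff_add_eq_0 add.commute)
  then show False using generic_weight_space_finite[of v] v assms by simp
qed

lemma infinite_dim_translate:
  assumes "infinite_dim (wt \<mu>)"
  shows "infinite_dim (wt (\<mu> + of_int k))"
proof -
  interpret m: w22_rep scale "\<lambda>n v. - X (- n) v" "\<lambda>n v. - J (- n) v" "- c" "- c1"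
    by (rule mirror)
  have m_wt: "m.wt (- \<nu>) = wt \<nu>" for \<nu> by auto
  have down: "infinite_dim (wt (\<nu> - 1))" if "infinite_dim (wt \<nu>)" for \<nu>
  proof -
    have "infinite_dim (m.wt (- \<nu> + 1))"
      using m.infinite_dim_next[of "- \<nu>"] that by (simp only: m_wt)
    moreover have "- \<nu> + 1 = - (\<nu> - 1)" by simp
    ultimately show ?thesis by (simp only: m_wt)
  qed
  show ?thesis
  proof (induction k rule: int_induct[of _ 0])
    case (step1 i)
    then show ?case using infinite_dim_next[of "\<mu> + of_int i"] by (simp add: add.assoc)
  next
    case (step2 i)
    then show ?case using down[of "\<mu> + of_int i"] by (simp add: algebra_simps)
  qed (use assms in simp)
qed

end


section \<open>From modules over \<open>W(2,2)\<close> to families of operators\<close>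

context w22_module
begin

lemma act_linear: "Vector_Spaces.linear scale scale (act x)"
  by unfold_locales (simp_all add: act_add_right act_scale_right)

lemma act_zero [simp]: "act 0 v = 0" "act x 0 = 0"
  using act_scale_left[of 0 0 v] act_scale_right[of x 0 0] by simp_all

lemma submoduleI:
  assumes W: "V.subspace W" and gen: "\<And>b w. w \<in> W \<Longrightarrow> act (w22_of b) w \<in> W"
  shows "submodule W"
proof -
  have "\<forall>w\<in>W. act x w \<in> W" for x
    by (induction x rule: w22_induct)
      (use W gen in \<open>auto simp: act_add_left act_scale_left V.subspace_0 V.subspace_add V.subspace_scale\<close>)
  then show ?thesis using W unfolding submodule_def by blast
qed

lemma act_of_of:
  "act (w22_of a) (act (w22_of b) v) = act (w22_of b) (act (w22_of a) v) + act (w22_basis_bracket a b) v"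
  using act_bracket[of "w22_of a" "w22_of b" v] by (simp add: w22_bracket_of)

lemma countable_dim_if_irreducible:
  assumes irreducible
  shows "\<exists>S. countable S \<and> V.span S = UNIV"
proof -
  obtain v :: 'v where "v \<noteq> 0" using assms unfolding irreducible_def by blast
  define act_word where "act_word bs = foldr (\<lambda>b. act (w22_of b)) bs v" for bs
  have "b \<in> range x_gen \<union> range I_gen \<union> {C_gen, C1_gen}" for b by (cases b) auto
  moreover have "countable (range x_gen \<union> range I_gen \<union> {C_gen, C1_gen})" by simp
  ultimately have "countable (UNIV :: w22_basis set)" by (metis UNIV_eq_I)
  then have "countable (range act_word)" using countable_lists[of "UNIV :: w22_basis set"] by simp
  moreover have "submodule (V.span (range act_word))"
  proof (rule submoduleI)
    fix b w assume w: "w \<in> V.span (range act_word)"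
    have "act (w22_of b) (act_word bs) = act_word (b # bs)" for bs by (simp add: act_word_def)
    then have "act (w22_of b) ` range act_word \<subseteq> V.span (range act_word)"
      by (auto intro: V.span_base)
    then show "act (w22_of b) w \<in> V.span (range act_word)"
      by (rule V.span_invariant[OF act_linear _ w])
  qed simp
  then have "V.span (range act_word) = {0} \<or> V.span (range act_word) = UNIV"
    using assms unfolding irreducible_def by blast
  moreover have "v \<in> V.span (range act_word)"
    by (rule V.span_base) (auto intro!: image_eqI[of _ _ "[]"] simp: act_word_def)
  ultimately show ?thesis using \<open>v \<noteq> 0\<close> by blast
qed

text \<open>Schur's lemma in countable dimension.\<close>

lemma central_acts_by_scalar:
  assumes irr: irreducible and central: "\<And>b. w22_basis_bracket z b = 0"
  shows "\<exists>a. \<forall>v. act (w22_of z) v = scale a v"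
proof -
  interpret complex_vector_space scale ..
  let ?T = "act (w22_of z)"
  interpret T: Vector_Spaces.linear scale scale ?T by (rule act_linear)
  have comm: "act (w22_of b) (?T v) = ?T (act (w22_of b) v)" for b v
    using act_of_of[of z b v] central by simp
  have lin: "act (w22_of b) (?T v - scale a v)
      = ?T (act (w22_of b) v) - scale a (act (w22_of b) v)" for b a v
  proof -
    interpret B: Vector_Spaces.linear scale scale "act (w22_of b)" by (rule act_linear)
    show ?thesis by (simp add: B.diff B.scale comm)
  qed
  obtain e :: 'v where "e \<noteq> 0" using irr unfolding irreducible_def by blast
  obtain S where S: "countable S" "V.span S = UNIV"
    using countable_dim_if_irreducible[OF irr] by blast
  have "\<exists>a. \<exists>u\<in>UNIV. u \<noteq> 0 \<and> ?T u = scale a u"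
  proof (rule eigenvector_if_countable_dim[OF act_linear _ _ _ S(1)])
    show "UNIV \<noteq> {0 :: 'v}" using \<open>e \<noteq> 0\<close> by blast
    fix a assume inj: "\<And>u. u \<in> UNIV \<Longrightarrow> ?T u = scale a u \<Longrightarrow> u = 0"
    interpret D: Vector_Spaces.linear scale scale "\<lambda>u. ?T u - scale a u"
      by unfold_locales (simp_all add: T.add T.scale algebra_simps)
    have "submodule (range (\<lambda>u. ?T u - scale a u))"
      by (rule submoduleI) (auto simp: lin D.subspace_image[OF V.subspace_UNIV])
    then have "range (\<lambda>u. ?T u - scale a u) = {0} \<or> range (\<lambda>u. ?T u - scale a u) = UNIV"
      using irr unfolding irreducible_def by blast
    moreover have "?T e - scale a e \<noteq> 0"
      using inj[OF UNIV_I] \<open>e \<noteq> 0\<close> by (metis right_minus_eq)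
    ultimately show "UNIV \<subseteq> range (\<lambda>u. ?T u - scale a u)" by blast
  qed (use S in auto)
  then obtain a u where u: "u \<noteq> 0" "?T u = scale a u" by blast
  have "submodule {v. ?T v = scale a v}"
    by (rule submoduleI) (auto simp: V.subspace_def T.add T.scale algebra_simps act_scale_right
        simp flip: comm)
  then have "{v. ?T v = scale a v} = UNIV"
    using irr u unfolding irreducible_def by blast
  then show ?thesis by blast
qed

lemma w22_rep_if_irreducible:
  assumes irr: irreducible and inf: "V.infinite_dim (weight_space \<mu>)"
  shows "\<exists>c c1. w22_rep scale (\<lambda>n. act (w22_of (x_gen n))) (\<lambda>n. act (w22_of (I_gen n))) c c1"
proof -
  interpret complex_vector_space scale ..
  obtain c where c: "\<And>v. act (w22_of C_gen) v = scale c v"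
    using central_acts_by_scalar[OF irr, of C_gen] by auto
  obtain c1 where c1: "\<And>v. act (w22_of C1_gen) v = scale c1 v"
    using central_acts_by_scalar[OF irr, of C1_gen] by auto
  have "w22_rep scale (\<lambda>n. act (w22_of (x_gen n))) (\<lambda>n. act (w22_of (I_gen n))) c c1"
  proof unfold_locales
    fix n m v
    show "act (w22_of (x_gen n)) (act (w22_of (x_gen m)) v)
      = act (w22_of (x_gen m)) (act (w22_of (x_gen n)) v)
        + scale (of_int (m - n)) (act (w22_of (x_gen (n + m))) v) + scale (w22_cocycle n m * c) v"
      by (subst act_of_of) (simp add: act_add_left act_scale_left c add.assoc)
    show "act (w22_of (x_gen n)) (act (w22_of (I_gen m)) v)
      = act (w22_of (I_gen m)) (act (w22_of (x_gen n)) v)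
        + scale (of_int (m - n)) (act (w22_of (I_gen (n + m))) v) + scale (w22_cocycle n m * c1) v"
      by (subst act_of_of) (simp add: act_add_left act_scale_left c1 add.assoc)
    show "act (w22_of (I_gen n)) (act (w22_of (I_gen m)) v)
      = act (w22_of (I_gen m)) (act (w22_of (I_gen n)) v)"
      by (subst act_of_of) simp
  next
    fix W assume W: "V.subspace W" "\<And>n w. w \<in> W \<Longrightarrow> act (w22_of (x_gen n)) w \<in> W"
      "\<And>n w. w \<in> W \<Longrightarrow> act (w22_of (I_gen n)) w \<in> W"
    have "submodule W"
    proof (rule submoduleI[OF W(1)])
      show "act (w22_of b) w \<in> W" if "w \<in> W" for b w
        by (cases b) (use W that c c1 V.subspace_scale[OF W(1)] in auto)
    qed
    then show "W = {0} \<or> W = UNIV" using irr unfolding irreducible_def by blast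
  next
    show "\<exists>S. countable S \<and> V.span S = UNIV" by (rule countable_dim_if_irreducible[OF irr])
    show "\<exists>\<nu>. V.infinite_dim {v. act (w22_of (x_gen 0)) v = scale \<nu> v}"
      using inf unfolding weight_space_def by blast
  qed (simp_all add: act_add_right act_scale_right)
  then show ?thesis by blast
qed

end

theorem theorem1p4:
  fixes scale :: "complex \<Rightarrow> 'v::ab_group_add \<Rightarrow> 'v"
    and act :: "w22 \<Rightarrow> 'v \<Rightarrow> 'v"
    and \<mu> :: complex
  assumes "w22_module scale act"
    and "lie_module.irreducible scale act"
    and "w22_module.weight_module scale act"
    and "vector_space.infinite_dim scale (w22_module.weight_space scale act \<mu>)"
  shows "w22_module.Supp scale act = {\<mu> + of_int k |k. True} \<and>
    (\<forall>k::int. vector_space.infinite_dim scale (w22_module.weight_space scale act (\<mu> + of_int k)))"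
proof -
  interpret w22_module scale act by fact
  obtain c c1 where
    "w22_rep scale (\<lambda>n. act (w22_of (x_gen n))) (\<lambda>n. act (w22_of (I_gen n))) c c1"
    using w22_rep_if_irreducible[OF assms(2,4)] by blast
  then interpret R: w22_rep scale "\<lambda>n. act (w22_of (x_gen n))" "\<lambda>n. act (w22_of (I_gen n))" c c1 .
  have ws: "weight_space \<nu> = R.wt \<nu>" for \<nu> unfolding weight_space_def ..
  have inf: "V.infinite_dim (R.wt (\<mu> + of_int k))" for k
    using R.infinite_dim_translate[of \<mu> k] assms(4) unfolding ws .
  have nonzero: "\<exists>v \<in> R.wt (\<mu> + of_int k). v \<noteq> 0" for k
    using V.infinite_dim_nonzero[OF R.subspace_wt inf] by metis
  obtain v where "v \<in> R.wt \<mu>" "v \<noteq> 0" using nonzero[of 0] by auto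
  then have "\<nu> \<in> Supp \<longleftrightarrow> \<nu> \<in> {\<mu> + of_int k |k. True}" for \<nu>
    using R.wt_zero_outside_coset[of v \<mu> \<nu>] nonzero unfolding Supp_def ws by blast
  then show ?thesis using inf unfolding ws by blast
qed

end
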